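(* Let $(M,g)$ be a Riemannian manifold of dimension $n$. Then: (1) $(h_{\tilde Q},\tilde J)$ is an almost Hermitian structure on $\widetilde{TM}$, that is, $\tilde J^2=-I$ and $h_{\tilde Q}(\tilde JX,\tilde JY)=h_{\tilde Q}(X,Y)$ for all vector fields $X,Y$ on $\widetilde{TM}$; (2) the associated almost symplectic structure $\Omega_{\tilde J}^{h_{\tilde Q}}(X,Y)=h_{\tilde Q}(\tilde JX,Y)$ is given in the adapted basis by $\Omega_{\tilde J}^{h_{\tilde Q}}=\frac{4}{\|y\|}g_{ij}(x)\,\delta y^i\wedge dx^j$.
   Context: Let $(x^i)$ be local coordinates on $M$, $(x^i,y^i)$ the induced coordinates on $TM$, $\widetilde{TM}=TM\setminus\{0\}$ the tangent bundle minus its zero section, $g_{ij}$ the components of $g$, $\Gamma_{ij}{}^k$ the Christoffel symbols of its Levi-Civita connection; the summation convention is used. Put $\|y\|=\sqrt{g_{ij}(x)y^iy^j}$. Define the adapted local frame $X_i=\frac{\partial}{\partial x^i}-y^a\Gamma_{ai}{}^m\frac{\partial}{\partial y^m}$, $X_{\bar i}=\frac{\partial}{\partial y^i}$ of $T\widetilde{TM}$, with dual coframe $dx^i$, $\delta y^i=dy^i+y^a\Gamma_{aj}{}^i dx^j$. $h_{\tilde Q}$ is the Riemannian metric $h_{\tilde Q}=2g_{ij}dx^idx^j+\frac{2g_{ij}}{\|y\|^2}\delta y^i\delta y^j$, i.e. $h_{\tilde Q}(X_i,X_j)=2g_{ij}$, $h_{\tilde Q}(X_i,X_{\bar j})=0$,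 $h_{\tilde Q}(X_{\bar i},X_{\bar j})=\frac{2}{\|y\|^2}g_{ij}$. $\tilde J$ is the $(1,1)$ tensor field given by $\tilde J(X_i)=-\|y\|X_{\bar i}$, $\tilde J(X_{\bar i})=\frac1{\|y\|}X_i$. The wedge product convention for 1-forms is $\alpha\wedge\beta=\frac12(\alpha\otimes\beta-\beta\otimes\alpha)$. *)

theory Defs
  imports "HOL-Analysis.Analysis" "HOL-Library.Function_Algebras"
begin

instantiation "fun" :: (type, real_vector) real_vector
begin

definition scaleR_fun :: "real \<Rightarrow> ('a \<Rightarrow> 'b) \<Rightarrow> 'a \<Rightarrow> 'b"
  where "scaleR_fun r f = (\<lambda>x. r *\<^sub>R f x)"

instance
  by standard (auto simp: scaleR_fun_def plus_fun_def scaleR_add_right scaleR_add_left)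

end


section \<open>Smooth maps\<close>

text \<open>For open \<open>S\<close>, \<open>Ck_on k S\<close> is the class \<open>C\<close>-\<open>k\<close> on \<open>S\<close>.\<close>

primrec Ck_on :: "nat \<Rightarrow> 'a::euclidean_space set \<Rightarrow> ('a \<Rightarrow> 'b::real_normed_vector) \<Rightarrow> bool"
  where
    "Ck_on 0 S f \<longleftrightarrow> continuous_on S f"
  | "Ck_on (Suc k) S f \<longleftrightarrow>
       (\<forall>x\<in>S. f differentiable (at x)) \<and> (\<forall>v. Ck_on k S (\<lambda>x. frechet_derivative f (at x) v))"

definition smooth_on :: "'a::euclidean_space set \<Rightarrow> ('a \<Rightarrow> 'b::real_normed_vector) \<Rightarrow> bool"
  where "smooth_on S f \<longleftrightarrow> (\<forall>k. Ck_on k S f)"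


section \<open>Smooth manifolds and tangent vectors\<close>

text \<open>A chart is a domain together with a coordinate map; only the values of the map on the
  domain matter.\<close>

type_synonym ('a, 'e) chart = "'a set \<times> ('a \<Rightarrow> 'e)"

definition chart_inv :: "('a, 'e) chart \<Rightarrow> 'e \<Rightarrow> 'a"
  where "chart_inv c = inv_into (fst c) (snd c)"

definition transition :: "('a, 'e) chart \<Rightarrow> ('a, 'e) chart \<Rightarrow> 'e \<Rightarrow> 'e"
  where "transition c d = snd d \<circ> chart_inv c"

definition smooth_manifold :: "'a topology \<Rightarrow> ('a, 'e::euclidean_space) chart set \<Rightarrow> bool"
  where "smooth_manifold T A \<longleftrightarrow>
    Hausdorff_space T \<and> second_countable T \<and>
    topspace T = \<Union>(fst ` A) \<and>
    (\<forall>c\<in>A. openin T (fst c) \<and> open (snd c ` fst c) \<and>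
       homeomorphic_map (subtopology T (fst c)) (top_of_set (snd c ` fst c)) (snd c)) \<and>
    (\<forall>c\<in>A. \<forall>d\<in>A. smooth_on (snd c ` (fst c \<inter> fst d)) (transition c d))"

text \<open>A tangent vector at \<open>p\<close> is the family of its coordinate vectors in all charts around \<open>p\<close>,
  which are related by the Jacobians of the transition maps. By convention the family is
  \<open>0\<close> at every other index, so that equality and the vector space operations are those of
  functions.\<close>

type_synonym ('a, 'e) tvec = "('a, 'e) chart \<Rightarrow> 'e"

definition tangent_space ::
    "('a, 'e::euclidean_space) chart set \<Rightarrow> 'a \<Rightarrow> ('a, 'e) tvec set"
  where "tangent_space A p = {v.
    (\<forall>c\<in>A. \<forall>d\<in>A. p \<in> fst c \<inter> fst d \<longrightarrow>
        v d = frechet_derivative (transition c d) (at (snd c p)) (v c)) \<and>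
    (\<forall>c. c \<notin> A \<or> p \<notin> fst c \<longrightarrow> v c = 0)}"

text \<open>The tangent vector at \<open>p\<close> whose coordinate vector in the chart \<open>c\<close> is \<open>w\<close>.\<close>

definition tangent_of ::
    "('a, 'e::euclidean_space) chart set \<Rightarrow> ('a, 'e) chart \<Rightarrow> 'a \<Rightarrow> 'e \<Rightarrow> ('a, 'e) tvec"
  where "tangent_of A c p w = (\<lambda>d.
    if d \<in> A \<and> p \<in> fst d
    then frechet_derivative (transition c d) (at (snd c p)) w else 0)"


section \<open>Riemannian metrics and almost Hermitian structures\<close>

text \<open>A tensor field is a family of multilinear maps on the tangent spaces; its values at
  arguments outside the tangent space are irrelevant. It is smooth if its components with
  respect to the coordinate frame of every chart are.\<close>

definition riemannian_metric ::
    "('a, 'e::euclidean_space) chart set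
      \<Rightarrow> ('a \<Rightarrow> ('a, 'e) tvec \<Rightarrow> ('a, 'e) tvec \<Rightarrow> real) \<Rightarrow> bool"
  where "riemannian_metric A g \<longleftrightarrow>
    (\<forall>p\<in>\<Union>(fst ` A).
       (\<forall>v\<in>tangent_space A p. \<forall>w\<in>tangent_space A p. g p v w = g p w v) \<and>
       (\<forall>v\<in>tangent_space A p. \<forall>v'\<in>tangent_space A p. \<forall>w\<in>tangent_space A p. \<forall>a b.
          g p (a *\<^sub>R v + b *\<^sub>R v') w = a * g p v w + b * g p v' w) \<and>
       (\<forall>v\<in>tangent_space A p. v \<noteq> 0 \<longrightarrow> g p v v > 0)) \<and>
    (\<forall>c\<in>A. \<forall>v w. smooth_on (snd c ` fst c)
       (\<lambda>x. g (chart_inv c x) (tangent_of A c (chart_inv c x) v)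
                             (tangent_of A c (chart_inv c x) w)))"

definition endomorphism_field ::
    "('a, 'e::euclidean_space) chart set
      \<Rightarrow> ('a \<Rightarrow> ('a, 'e) tvec \<Rightarrow> ('a, 'e) tvec) \<Rightarrow> bool"
  where "endomorphism_field A J \<longleftrightarrow>
    (\<forall>p\<in>\<Union>(fst ` A).
       (\<forall>v\<in>tangent_space A p. J p v \<in> tangent_space A p) \<and>
       (\<forall>v\<in>tangent_space A p. \<forall>w\<in>tangent_space A p. \<forall>a b.
          J p (a *\<^sub>R v + b *\<^sub>R w) = a *\<^sub>R J p v + b *\<^sub>R J p w)) \<and>
    (\<forall>c\<in>A. \<forall>w. smooth_on (snd c ` fst c)
       (\<lambda>x. J (chart_inv c x) (tangent_of A c (chart_inv c x) w) c))"

definition almost_hermitian ::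
    "('a, 'e::euclidean_space) chart set
      \<Rightarrow> ('a \<Rightarrow> ('a, 'e) tvec \<Rightarrow> ('a, 'e) tvec \<Rightarrow> real)
      \<Rightarrow> ('a \<Rightarrow> ('a, 'e) tvec \<Rightarrow> ('a, 'e) tvec) \<Rightarrow> bool"
  where "almost_hermitian A h J \<longleftrightarrow>
    riemannian_metric A h \<and> endomorphism_field A J \<and>
    (\<forall>p\<in>\<Union>(fst ` A). \<forall>X\<in>tangent_space A p. J p (J p X) = - X) \<and>
    (\<forall>p\<in>\<Union>(fst ` A). \<forall>X\<in>tangent_space A p. \<forall>Y\<in>tangent_space A p.
       h p (J p X) (J p Y) = h p X Y)"

definition fundamental_form ::
    "('a \<Rightarrow> ('a, 'e) tvec \<Rightarrow> ('a, 'e) tvec \<Rightarrow> real)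
      \<Rightarrow> ('a \<Rightarrow> ('a, 'e) tvec \<Rightarrow> ('a, 'e) tvec)
      \<Rightarrow> 'a \<Rightarrow> ('a, 'e) tvec \<Rightarrow> ('a, 'e) tvec \<Rightarrow> real"
  where "fundamental_form h J p X Y = h p (J p X) Y"

definition wedge :: "('v \<Rightarrow> real) \<Rightarrow> ('v \<Rightarrow> real) \<Rightarrow> 'v \<Rightarrow> 'v \<Rightarrow> real"  (infixr \<open>\<and>\<^sub>w\<close> 70)
  where "(\<alpha> \<and>\<^sub>w \<beta>) X Y = (\<alpha> X * \<beta> Y - \<beta> X * \<alpha> Y) / 2"


section \<open>Components of the metric and Christoffel symbols\<close>

definition metric_comp ::
    "('a, real^'n) chart set \<Rightarrow> ('a \<Rightarrow> ('a, real^'n) tvec \<Rightarrow> ('a, real^'n) tvec \<Rightarrow> real)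
      \<Rightarrow> ('a, real^'n) chart \<Rightarrow> real^'n \<Rightarrow> real^'n^'n"
  where "metric_comp A g c x = (\<chi> i j.
    g (chart_inv c x) (tangent_of A c (chart_inv c x) (axis i 1))
                      (tangent_of A c (chart_inv c x) (axis j 1)))"

definition partial :: "'n \<Rightarrow> (real^'n \<Rightarrow> real) \<Rightarrow> real^'n \<Rightarrow> real"
  where "partial i f x = frechet_derivative f (at x) (axis i 1)"

text \<open>\<open>christoffel A g c x i j k\<close> is the symbol with lower indices \<open>i\<close>, \<open>j\<close> and upper index \<open>k\<close>
  of the Levi-Civita connection, at the point with coordinates \<open>x\<close> in the chart \<open>c\<close>.\<close>

definition christoffel ::
    "('a, real^'n) chart set \<Rightarrow> ('a \<Rightarrow> ('a, real^'n) tvec \<Rightarrow> ('a, real^'n) tvec \<Rightarrow> real)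
      \<Rightarrow> ('a, real^'n) chart \<Rightarrow> real^'n \<Rightarrow> 'n \<Rightarrow> 'n \<Rightarrow> 'n \<Rightarrow> real"
  where "christoffel A g c x i j k =
    (\<Sum>l\<in>UNIV. matrix_inv (metric_comp A g c x) $ k $ l *
       (partial i (\<lambda>x. metric_comp A g c x $ j $ l) x
        + partial j (\<lambda>x. metric_comp A g c x $ i $ l) x
        - partial l (\<lambda>x. metric_comp A g c x $ i $ j) x)) / 2"


section \<open>The Christoffel symbols are those of the Levi-Civita connection\<close>

lemma smooth_manifold_chart:
  assumes M: "smooth_manifold T A" and c: "c \<in> A"
  shows "inj_on (snd c) (fst c)" "open (snd c ` fst c)"
proof -
  have o: "openin T (fst c)" "open (snd c ` fst c)"
    "homeomorphic_map (subtopology T (fst c)) (top_of_set (snd c ` fst c)) (snd c)"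
    using M c unfolding smooth_manifold_def by blast+
  show "open (snd c ` fst c)" by (rule o(2))
  have "topspace (subtopology T (fst c)) = fst c"
    using openin_subset[OF o(1)] by auto
  then show "inj_on (snd c) (fst c)"
    using o(3) by (metis homeomorphic_map_def)
qed

lemma chart_inv_eq:
  assumes "smooth_manifold T A" "c \<in> A" "p \<in> fst c"
  shows "chart_inv c (snd c p) = p"
  using assms smooth_manifold_chart(1) unfolding chart_inv_def by (metis inv_into_f_f)

lemma chart_open_image:
  assumes M: "smooth_manifold T A" and c: "c \<in> A" and d: "d \<in> A"
  shows "open (snd c ` (fst c \<inter> fst d))"
proof -
  have o: "openin T (fst c)" "openin T (fst d)" "open (snd c ` fst c)"
    "homeomorphic_map (subtopology T (fst c)) (top_of_set (snd c ` fst c)) (snd c)"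
    using M c d unfolding smooth_manifold_def by blast+
  have "open_map (subtopology T (fst c)) (top_of_set (snd c ` fst c)) (snd c)"
    using o(4) homeomorphic_imp_open_map by blast
  moreover have "openin (subtopology T (fst c)) (fst c \<inter> fst d)"
    using o(2) by (simp add: openin_subtopology_Int2)
  ultimately have "openin (top_of_set (snd c ` fst c)) (snd c ` (fst c \<inter> fst d))"
    unfolding open_map_def by blast
  then show ?thesis using o(3) openin_open_eq by blast
qed

lemma transition_has_derivative:
  assumes M: "smooth_manifold T A" and c: "c \<in> A" and d: "d \<in> A" and p: "p \<in> fst c" "p \<in> fst d"
  shows "(transition c d has_derivative frechet_derivative (transition c d) (at (snd c p)))
           (at (snd c p))"
proof -
  have "smooth_on (snd c ` (fst c \<inter> fst d)) (transition c d)"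
    using M c d unfolding smooth_manifold_def by blast
  then have "Ck_on (Suc 0) (snd c ` (fst c \<inter> fst d)) (transition c d)"
    unfolding smooth_on_def by blast
  then have "transition c d differentiable (at (snd c p))"
    using p by auto
  then show ?thesis by (simp add: frechet_derivative_works)
qed

lemma frechet_derivative_transition_comp:
  assumes M: "smooth_manifold T A" and c: "c \<in> A" and d: "d \<in> A" and e: "e \<in> A"
    and p: "p \<in> fst c" "p \<in> fst d" "p \<in> fst e"
  shows "frechet_derivative (transition d e) (at (snd d p))
           (frechet_derivative (transition c d) (at (snd c p)) w)
         = frechet_derivative (transition c e) (at (snd c p)) w"
proof -
  have cd: "transition c d (snd c p) = snd d p"
    using chart_inv_eq[OF M c p(1)] by (simp add: transition_def)
  have "(transition d e \<circ> transition c d has_derivative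
      frechet_derivative (transition d e) (at (snd d p)) \<circ>
      frechet_derivative (transition c d) (at (snd c p))) (at (snd c p))"
    using diff_chain_at transition_has_derivative[OF M c d p(1,2)]
      transition_has_derivative[OF M d e p(2,3)] cd by metis
  moreover have "(transition d e \<circ> transition c d) y = transition c e y"
    if "y \<in> snd c ` (fst c \<inter> fst d)" for y
    using that chart_inv_eq[OF M c] chart_inv_eq[OF M d] by (auto simp: transition_def)
  moreover have "snd c p \<in> snd c ` (fst c \<inter> fst d)"
    using p by blast
  ultimately have "(transition c e has_derivative
      frechet_derivative (transition d e) (at (snd d p)) \<circ>
      frechet_derivative (transition c d) (at (snd c p))) (at (snd c p))"
    using has_derivative_transform_within_open chart_open_image[OF M c d] by blast
  then have "frechet_derivative (transition d e) (at (snd d p)) \<circ>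
      frechet_derivative (transition c d) (at (snd c p))
      = frechet_derivative (transition c e) (at (snd c p))"
    using transition_has_derivative[OF M c e p(1,3)] has_derivative_unique by blast
  then show ?thesis by (metis comp_apply)
qed

lemma frechet_derivative_transition_self:
  assumes M: "smooth_manifold T A" and c: "c \<in> A" and p: "p \<in> fst c"
  shows "frechet_derivative (transition c c) (at (snd c p)) w = w"
proof -
  have "((\<lambda>y. y) has_derivative (\<lambda>y. y)) (at (snd c p))"
    by (rule has_derivative_ident)
  moreover have "y = transition c c y" if "y \<in> snd c ` fst c" for y
    using that chart_inv_eq[OF M c] by (auto simp: transition_def)
  ultimately have "(transition c c has_derivative (\<lambda>y. y)) (at (snd c p))"
    using has_derivative_transform_within_open smooth_manifold_chart(2)[OF M c] p
    by (metis (no_types, lifting) image_eqI)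
  then show ?thesis
    using transition_has_derivative[OF M c c p p] has_derivative_unique by metis
qed

lemma tangent_of_in_tangent_space:
  assumes M: "smooth_manifold T A" and c: "c \<in> A" and p: "p \<in> fst c"
  shows "tangent_of A c p w \<in> tangent_space A p"
  using frechet_derivative_transition_comp[OF M c _ _ p]
  by (auto simp: tangent_space_def tangent_of_def)

lemma tangent_of_linear:
  assumes M: "smooth_manifold T A" and c: "c \<in> A" and p: "p \<in> fst c"
  shows "linear (tangent_of A c p)"
proof -
  have L: "linear (frechet_derivative (transition c d) (at (snd c p)))"
    if "d \<in> A" "p \<in> fst d" for d
    using transition_has_derivative[OF M c that(1) p that(2)] has_derivative_linear by blast
  show ?thesis
    by (rule linearI)
      (auto simp: tangent_of_def plus_fun_def scaleR_fun_def fun_eq_iff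
        linear_add[OF L] linear_scale[OF L])
qed

lemma tangent_of_self:
  assumes M: "smooth_manifold T A" and c: "c \<in> A" and p: "p \<in> fst c"
  shows "tangent_of A c p w c = w"
  using frechet_derivative_transition_self[OF assms] c p by (simp add: tangent_of_def)

lemma riemannian_metricD:
  assumes g: "riemannian_metric A g" and p: "p \<in> \<Union>(fst ` A)"
  shows "v \<in> tangent_space A p \<Longrightarrow> w \<in> tangent_space A p \<Longrightarrow> g p v w = g p w v"
    and "v \<in> tangent_space A p \<Longrightarrow> v' \<in> tangent_space A p \<Longrightarrow> w \<in> tangent_space A p \<Longrightarrow>
          g p (a *\<^sub>R v + b *\<^sub>R v') w = a * g p v w + b * g p v' w"
    and "v \<in> tangent_space A p \<Longrightarrow> v \<noteq> 0 \<Longrightarrow> g p v v > 0"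
proof -
  note D = bspec[OF conjunct1[OF g[unfolded riemannian_metric_def]] p]
  show "v \<in> tangent_space A p \<Longrightarrow> w \<in> tangent_space A p \<Longrightarrow> g p v w = g p w v"
    using conjunct1[OF D] by simp
  show "v \<in> tangent_space A p \<Longrightarrow> v' \<in> tangent_space A p \<Longrightarrow> w \<in> tangent_space A p \<Longrightarrow>
          g p (a *\<^sub>R v + b *\<^sub>R v') w = a * g p v w + b * g p v' w"
    using conjunct1[OF conjunct2[OF D]] by simp
  show "v \<in> tangent_space A p \<Longrightarrow> v \<noteq> 0 \<Longrightarrow> g p v v > 0"
    using conjunct2[OF conjunct2[OF D]] by simp
qed

lemma metric_comp_sym:
  assumes M: "smooth_manifold T A" and g: "riemannian_metric A g" and c: "c \<in> A"
    and x: "x \<in> snd c ` fst c"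
  shows "metric_comp A g c x $ i $ j = metric_comp A g c x $ j $ i"
proof -
  obtain p where p: "p \<in> fst c" "x = snd c p" using x by blast
  then have "p \<in> \<Union>(fst ` A)" using c by blast
  then show ?thesis
    using riemannian_metricD(1)[OF g] tangent_of_in_tangent_space[OF M c p(1)]
      p chart_inv_eq[OF M c p(1)]
    by (simp add: metric_comp_def)
qed

lemma metric_comp_apply:
  fixes A :: "('a, real^'n) chart set"
  assumes M: "smooth_manifold T A" and g: "riemannian_metric A g" and c: "c \<in> A"
    and p: "p \<in> fst c"
  shows "g p (tangent_of A c p v) (tangent_of A c p w)
         = v \<bullet> (metric_comp A g c (snd c p) *v w)"
proof -
  let ?t = "tangent_of A c p"
  have pA: "p \<in> \<Union>(fst ` A)" using c p by blast
  note tin = tangent_of_in_tangent_space[OF M c p]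
  note tl = tangent_of_linear[OF M c p]
  have sym: "g p v w = g p w v" if "v \<in> tangent_space A p" "w \<in> tangent_space A p" for v w
    by (rule riemannian_metricD(1)[OF g pA that])
  have lin: "g p (a *\<^sub>R v + b *\<^sub>R v') w = a * g p v w + b * g p v' w"
    if "v \<in> tangent_space A p" "v' \<in> tangent_space A p" "w \<in> tangent_space A p" for a b v v' w
    by (rule riemannian_metricD(2)[OF g pA that])
  have l1: "linear (\<lambda>v. g p (?t v) z)" if "z \<in> tangent_space A p" for z
  proof (rule linearI)
    fix a b show "g p (?t (a + b)) z = g p (?t a) z + g p (?t b) z"
      using lin[OF tin tin that, of 1 a 1 b] by (simp add: linear_add[OF tl])
  next
    fix r a show "g p (?t (r *\<^sub>R a)) z = r *\<^sub>R g p (?t a) z"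
      using lin[OF tin tin that, of r a 0 a] by (simp add: linear_scale[OF tl])
  qed
  have e: "g p (?t v) z = (\<Sum>i\<in>UNIV. v $ i * g p (?t (axis i 1)) z)"
    if "z \<in> tangent_space A p" for v z
  proof -
    have "v = (\<Sum>i\<in>UNIV. v $ i *\<^sub>R axis i 1)"
      using basis_expansion[of v] by (simp add: scalar_mult_eq_scaleR)
    then have "g p (?t v) z = g p (?t (\<Sum>i\<in>UNIV. v $ i *\<^sub>R axis i 1)) z" by simp
    also have "\<dots> = (\<Sum>i\<in>UNIV. v $ i * g p (?t (axis i 1)) z)"
      using linear_sum[OF l1[OF that], of "\<lambda>i. v $ i *\<^sub>R axis i 1" UNIV]
        linear_scale[OF l1[OF that]] by simp
    finally show ?thesis .
  qed
  have "g p (?t v) (?t w) = (\<Sum>i\<in>UNIV. v $ i * g p (?t w) (?t (axis i 1)))"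
    using e[OF tin, of v w] sym[OF tin tin] by simp
  also have "\<dots> = (\<Sum>i\<in>UNIV. v $ i * (\<Sum>j\<in>UNIV. w $ j * g p (?t (axis j 1)) (?t (axis i 1))))"
    using e[OF tin, of w] by simp
  also have "\<dots> = v \<bullet> (metric_comp A g c (snd c p) *v w)"
    using sym[OF tin tin] chart_inv_eq[OF M c p]
    by (simp add: inner_vec_def matrix_vector_mult_def metric_comp_def mult.commute)
  finally show ?thesis .
qed

lemma metric_comp_invertible:
  fixes A :: "('a, real^'n) chart set"
  assumes M: "smooth_manifold T A" and g: "riemannian_metric A g" and c: "c \<in> A"
    and x: "x \<in> snd c ` fst c"
  shows "invertible (metric_comp A g c x)"
proof -
  obtain p where p: "p \<in> fst c" "x = snd c p" using x by blast
  have pA: "p \<in> \<Union>(fst ` A)" using c p by blast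
  have "w = 0" if "metric_comp A g c x *v w = 0" for w
  proof (rule ccontr)
    assume "w \<noteq> 0"
    then have "tangent_of A c p w \<noteq> 0"
      using tangent_of_self[OF M c p(1), of w] by (metis zero_fun_apply)
    then have "g p (tangent_of A c p w) (tangent_of A c p w) > 0"
      using riemannian_metricD(3)[OF g pA tangent_of_in_tangent_space[OF M c p(1)]] by blast
    then show False
      using metric_comp_apply[OF M g c p(1), of w w] that p(2) by simp
  qed
  then show ?thesis
    by (simp add: invertible_left_inverse matrix_left_invertible_ker)
qed

text \<open>In local coordinates the Levi-Civita connection is the unique one that is torsion-free
  (\<open>G\<close> symmetric in its lower indices) and metric.\<close>

lemma christoffel_levi_civita:
  fixes A :: "('a, real^'n) chart set"
  assumes M: "smooth_manifold T A" and g: "riemannian_metric A g" and c: "c \<in> A"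
    and x: "x \<in> snd c ` fst c"
  shows "(\<forall>i j k. G i j k = G j i k) \<and>
      (\<forall>i j k. partial k (\<lambda>x. metric_comp A g c x $ i $ j) x =
         (\<Sum>l\<in>UNIV. G k i l * metric_comp A g c x $ l $ j + G k j l * metric_comp A g c x $ i $ l))
    \<longleftrightarrow> G = christoffel A g c x"
proof -
  define m where "m = metric_comp A g c x"
  define D where "D k i j = partial k (\<lambda>x. metric_comp A g c x $ i $ j) x" for k i j
  define F where "F i j l = (D i j l + D j i l - D l i j) / 2" for i j l
  have ms: "m $ i $ j = m $ j $ i" for i j
    using metric_comp_sym[OF M g c x] by (simp add: m_def)
  have Ds: "D k i j = D k j i" for k i j
  proof -
    note o = smooth_manifold_chart(2)[OF M c]
    have imp: "((\<lambda>x. metric_comp A g c x $ i $ j) has_derivative d) (at x) \<Longrightarrow>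
          ((\<lambda>x. metric_comp A g c x $ j $ i) has_derivative d) (at x)" for d i j
      by (erule has_derivative_transform_within_open[OF _ o x]) (rule metric_comp_sym[OF M g c])
    have "((\<lambda>x. metric_comp A g c x $ i $ j) has_derivative d) (at x) \<longleftrightarrow>
          ((\<lambda>x. metric_comp A g c x $ j $ i) has_derivative d) (at x)" for d
      by (rule iffI; erule imp)
    then show ?thesis by (simp add: D_def partial_def frechet_derivative_def)
  qed
  have inv: "m ** matrix_inv m = mat 1" "matrix_inv m ** m = mat 1"
    using someI_ex[OF metric_comp_invertible[OF M g c x, unfolded invertible_def]]
    unfolding m_def matrix_inv_def by blast+
  have ch: "christoffel A g c x i j k = (\<Sum>l\<in>UNIV. matrix_inv m $ k $ l * F i j l)" for i j k
    by (simp add: christoffel_def m_def D_def F_def sum_divide_distrib)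
  have lower: "(\<Sum>k\<in>UNIV. m $ s $ k * (\<Sum>l\<in>UNIV. matrix_inv m $ k $ l * f l)) = f s" for f s
  proof -
    have "m *v (matrix_inv m *v (\<chi> l. f l)) = (\<chi> l. f l)"
      using inv by (simp add: matrix_vector_mul_assoc)
    from arg_cong[OF this, of "\<lambda>v. v $ s"] show ?thesis
      by (simp add: matrix_vector_mult_def)
  qed
  have raise: "(\<Sum>l\<in>UNIV. matrix_inv m $ s $ l * (\<Sum>k\<in>UNIV. m $ l $ k * f k)) = f s" for f s
  proof -
    have "matrix_inv m *v (m *v (\<chi> l. f l)) = (\<chi> l. f l)"
      using inv by (simp add: matrix_vector_mul_assoc)
    from arg_cong[OF this, of "\<lambda>v. v $ s"] show ?thesis
      by (simp add: matrix_vector_mult_def)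
  qed
  define L where "L i j s = (\<Sum>k\<in>UNIV. m $ s $ k * G i j k)" for i j s
  have iff: "G = christoffel A g c x \<longleftrightarrow> (\<forall>i j s. L i j s = F i j s)"
  proof
    assume "G = christoffel A g c x"
    then show "\<forall>i j s. L i j s = F i j s" by (simp add: L_def ch lower)
  next
    assume L: "\<forall>i j s. L i j s = F i j s"
    have "G i j k = christoffel A g c x i j k" for i j k
      using raise[of k "G i j"] L by (simp add: L_def ch)
    then show "G = christoffel A g c x" by blast
  qed
  have met: "(\<Sum>l\<in>UNIV. G k i l * m $ l $ j + G k j l * m $ i $ l) = L k i j + L k j i" for i j k
    using ms by (simp add: L_def sum.distrib mult.commute)
  have symL: "(\<forall>i j k. G i j k = G j i k) \<longleftrightarrow> (\<forall>i j s. L i j s = L j i s)"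
  proof
    assume L: "\<forall>i j s. L i j s = L j i s"
    have "G i j k = G j i k" for i j k
      using raise[of k "G i j"] raise[of k "G j i"] L by (simp add: L_def)
    then show "\<forall>i j k. G i j k = G j i k" by blast
  qed (simp add: L_def)
  have "(\<forall>i j s. L i j s = L j i s) \<and> (\<forall>i j k. D k i j = L k i j + L k j i)
        \<longleftrightarrow> (\<forall>i j s. L i j s = F i j s)"
  proof (intro iffI allI)
    fix i j s
    assume a: "(\<forall>i j s. L i j s = L j i s) \<and> (\<forall>i j k. D k i j = L k i j + L k j i)"
    then have "D i j s = L i j s + L i s j" "D j i s = L j i s + L j s i"
      "D s i j = L s i j + L s j i" "L j i s = L i j s" "L s i j = L i s j" "L s j i = L j s i"
      by blast+
    then show "L i j s = F i j s" by (simp add: F_def)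
  next
    assume L: "\<forall>i j s. L i j s = F i j s"
    show "(\<forall>i j s. L i j s = L j i s) \<and> (\<forall>i j k. D k i j = L k i j + L k j i)"
    proof (intro conjI allI)
      fix i j s show "L i j s = L j i s"
        using Ds[of s i j] L[rule_format, of i j s] L[rule_format, of j i s] by (simp add: F_def)
    next
      fix i j k show "D k i j = L k i j + L k j i"
        using Ds[of k i j] Ds[of i k j] Ds[of j k i] L[rule_format, of k i j] L[rule_format, of k j i]
        by (simp add: F_def field_simps)
    qed
  qed
  then show ?thesis
    using iff symL met unfolding m_def[symmetric] D_def[symmetric] by simp
qed


section \<open>The tangent bundle minus its zero section\<close>

text \<open>The chart of the slit tangent bundle induced by a chart \<open>c\<close> of the base manifold: its
  coordinates are the coordinates \<open>x\<close> of the base point and the components \<open>y\<close> of the vector.\<close>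

definition slit_chart ::
    "('a, 'e::euclidean_space) chart set \<Rightarrow> ('a, 'e) chart \<Rightarrow> ('a \<times> ('a, 'e) tvec, 'e \<times> 'e) chart"
  where "slit_chart A c =
    ({(p, v). p \<in> fst c \<and> v \<in> tangent_space A p \<and> v \<noteq> 0}, \<lambda>(p, v). (snd c p, v c))"

definition slit_tangent_bundle ::
    "('a, 'e::euclidean_space) chart set \<Rightarrow> ('a \<times> ('a, 'e) tvec, 'e \<times> 'e) chart set"
  where "slit_tangent_bundle A = slit_chart A ` A"

type_synonym ('a, 'n) slit_tvec =
  "('a \<times> ('a, real^'n) tvec, (real^'n) \<times> (real^'n)) tvec"

definition coord_x :: "('a, real^'n) chart \<Rightarrow> 'a \<times> ('a, real^'n) tvec \<Rightarrow> real^'n"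
  where "coord_x c u = snd c (fst u)"

definition coord_y :: "('a, real^'n) chart \<Rightarrow> 'a \<times> ('a, real^'n) tvec \<Rightarrow> real^'n"
  where "coord_y c u = snd u c"

context
  fixes A :: "('a, real^'n) chart set"
    and g :: "'a \<Rightarrow> ('a, real^'n) tvec \<Rightarrow> ('a, real^'n) tvec \<Rightarrow> real"
    and c :: "('a, real^'n) chart"
    and u :: "'a \<times> ('a, real^'n) tvec"
begin

definition g_at :: "'n \<Rightarrow> 'n \<Rightarrow> real"
  where "g_at i j = metric_comp A g c (coord_x c u) $ i $ j"

definition Gamma_at :: "'n \<Rightarrow> 'n \<Rightarrow> 'n \<Rightarrow> real"
  where "Gamma_at = christoffel A g c (coord_x c u)"

definition norm_y :: real
  where "norm_y = sqrt (\<Sum>i\<in>UNIV. \<Sum>j\<in>UNIV. g_at i j * coord_y c u $ i * coord_y c u $ j)"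

definition d_dx :: "'n \<Rightarrow> ('a, 'n) slit_tvec"
  where "d_dx i = tangent_of (slit_tangent_bundle A) (slit_chart A c) u (axis i 1, 0)"

definition d_dy :: "'n \<Rightarrow> ('a, 'n) slit_tvec"
  where "d_dy i = tangent_of (slit_tangent_bundle A) (slit_chart A c) u (0, axis i 1)"

definition X_hor :: "'n \<Rightarrow> ('a, 'n) slit_tvec"
  where "X_hor i =
    d_dx i - (\<Sum>m\<in>UNIV. (\<Sum>a\<in>UNIV. coord_y c u $ a * Gamma_at a i m) *\<^sub>R d_dy m)"

definition X_ver :: "'n \<Rightarrow> ('a, 'n) slit_tvec"
  where "X_ver i = d_dy i"

definition dx :: "'n \<Rightarrow> ('a, 'n) slit_tvec \<Rightarrow> real"
  where "dx i X = fst (X (slit_chart A c)) $ i"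

definition dy :: "'n \<Rightarrow> ('a, 'n) slit_tvec \<Rightarrow> real"
  where "dy i X = snd (X (slit_chart A c)) $ i"

definition delta_y :: "'n \<Rightarrow> ('a, 'n) slit_tvec \<Rightarrow> real"
  where "delta_y i X =
    dy i X + (\<Sum>a\<in>UNIV. \<Sum>j\<in>UNIV. coord_y c u $ a * Gamma_at a j i * dx j X)"

definition h_loc :: "('a, 'n) slit_tvec \<Rightarrow> ('a, 'n) slit_tvec \<Rightarrow> real"
  where "h_loc X Y =
    (\<Sum>i\<in>UNIV. \<Sum>j\<in>UNIV. 2 * g_at i j * dx i X * dx j Y) +
    (\<Sum>i\<in>UNIV. \<Sum>j\<in>UNIV. 2 * g_at i j / norm_y\<^sup>2 * delta_y i X * delta_y j Y)"

text \<open>The linear extension of \<open>X_hor i \<mapsto> - norm_y *\<^sub>R X_ver i\<close> and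
  \<open>X_ver i \<mapsto> (1 / norm_y) *\<^sub>R X_hor i\<close>; the coefficients of \<open>X\<close> in this frame are given by its
  dual coframe \<open>dx i\<close>, \<open>delta_y i\<close>.\<close>

definition J_loc :: "('a, 'n) slit_tvec \<Rightarrow> ('a, 'n) slit_tvec"
  where "J_loc X =
    (\<Sum>i\<in>UNIV. dx i X *\<^sub>R (- norm_y *\<^sub>R X_ver i)) +
    (\<Sum>i\<in>UNIV. delta_y i X *\<^sub>R ((1 / norm_y) *\<^sub>R X_hor i))"

end

text \<open>The global tensor fields are those given by the local expressions in \<^emph>\<open>every\<close> chart; the
  descriptions denote nothing useful unless these expressions agree on overlaps.\<close>

definition h_Q ::
    "('a, real^'n) chart set \<Rightarrow> ('a \<Rightarrow> ('a, real^'n) tvec \<Rightarrow> ('a, real^'n) tvec \<Rightarrow> real)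
      \<Rightarrow> 'a \<times> ('a, real^'n) tvec \<Rightarrow> ('a, 'n) slit_tvec \<Rightarrow> ('a, 'n) slit_tvec \<Rightarrow> real"
  where "h_Q A g u X Y = (THE r. \<forall>c\<in>A. u \<in> fst (slit_chart A c) \<longrightarrow> r = h_loc A g c u X Y)"

definition J_Q ::
    "('a, real^'n) chart set \<Rightarrow> ('a \<Rightarrow> ('a, real^'n) tvec \<Rightarrow> ('a, real^'n) tvec \<Rightarrow> real)
      \<Rightarrow> 'a \<times> ('a, real^'n) tvec \<Rightarrow> ('a, 'n) slit_tvec \<Rightarrow> ('a, 'n) slit_tvec"
  where "J_Q A g u X = (THE Z. \<forall>c\<in>A. u \<in> fst (slit_chart A c) \<longrightarrow> Z = J_loc A g c u X)"

end

theory Submission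
  imports Defs
begin

text \<open>
  In a chart, a tangent vector of the slit tangent bundle is determined by its base component
  \<open>\<xi>\<close> and its vertical component \<open>\<delta>\<close>, the values of \<open>dx\<close> and \<open>delta_y\<close>. In these terms the
  metric is \<open>2 g(\<xi>, \<xi>') + 2 g(\<delta>, \<delta>') / r\<^sup>2\<close> with \<open>r = norm_y\<close>, and the endomorphism maps
  \<open>(\<xi>, \<delta>)\<close> to \<open>(\<delta> / r, - r \<xi>)\<close>, so the algebraic identities are immediate. The point is that
  both are independent of the chart: under a change of charts with Jacobian \<open>P\<close>, \<open>(\<xi>, \<delta>)\<close>
  becomes \<open>(P \<xi>, P \<delta>)\<close>. For \<open>\<delta>\<close> this is the transformation law of the Christoffel symbols,
  which follows from the uniqueness of the Levi-Civita connection: the symbols pulled back from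
  the other chart are again torsion-free, by the symmetry of second derivatives, and metric.
\<close>

section \<open>Calculus of smooth maps\<close>

text \<open>\<open>h_Q\<close> and \<open>J_Q\<close> are definite descriptions over all charts, so
  nothing useful is known about their values until chart independence is settled; afterwards every
  identity is checked in a single chart around the point. The obstacle is that the slit bundle is a
  bare set of charts without a topology, so the facts stated for \<open>smooth_manifold\<close> do
  not apply to it. Its cocycle rule and the linear structure of its tangent spaces are derived
  instead from an explicit derivative of the transition map
  \<open>(x, y) \<mapsto> (t x, Dt(x) y)\<close>. That derivative contains the Hessian of
  \<open>t\<close>, and the Christoffel correction in \<open>delta_y\<close> absorbs it: the symbols
  change by the same Hessian with its two arguments swapped, a second place where symmetry of second
  derivatives enters. Smoothness is part of the claim as well: the norm is smooth because the zero
  section is removed, the Christoffel symbols because the inverse of a matrix is rational in its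
  entries.\<close>

lemma Ck_on_has_derivative:
  "Ck_on (Suc k) S f \<Longrightarrow> x \<in> S \<Longrightarrow> (f has_derivative frechet_derivative f (at x)) (at x)"
  by (simp add: frechet_derivative_works)

lemma Ck_on_derivative:
  "Ck_on (Suc k) S f \<Longrightarrow> Ck_on k S (\<lambda>x. frechet_derivative f (at x) v)"
  by simp

text \<open>Derivatives at a point of \<open>S\<close> only see values near it, and \<open>S\<close>
  is open, so agreement on \<open>S\<close> passes to the derivatives and the induction can continue
  with them.\<close>

lemma Ck_on_cong:
  assumes "open S" "\<And>x. x \<in> S \<Longrightarrow> f x = g x" "Ck_on k S f"
  shows "Ck_on k S g"
  using assms(2,3)
proof (induction k arbitrary: f g)
  case 0
  then show ?case using continuous_on_cong[of S S f g] by simp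
next
  case (Suc k)
  have D: "(g has_derivative frechet_derivative f (at x)) (at x)" if "x \<in> S" for x
    by (rule has_derivative_transform_within_open
        [OF Ck_on_has_derivative[OF Suc.prems(2) that] assms(1) that Suc.prems(1)])
  have "frechet_derivative f (at x) = frechet_derivative g (at x)" if "x \<in> S" for x
    by (rule frechet_derivative_at[OF D[OF that]])
  then have "Ck_on k S (\<lambda>x. frechet_derivative g (at x) v)" for v
    by (intro Suc.IH[OF _ Ck_on_derivative[OF Suc.prems(2)]]) simp
  with D show ?case by (auto simp: differentiable_def)
qed

text \<open>\<open>frechet_derivative\<close> is a choice term; this rule allows the derivative to
  be given by any formula \<open>f' x\<close>. The rules for sums, products, reciprocals and roots
  below differentiate by a known formula and then treat its directional values by induction.\<close>

lemma Ck_on_SucI: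
  assumes "open S" "\<And>x. x \<in> S \<Longrightarrow> (f has_derivative f' x) (at x)"
    and "\<And>v. Ck_on k S (\<lambda>x. f' x v)"
  shows "Ck_on (Suc k) S f"
proof -
  have "Ck_on k S (\<lambda>x. frechet_derivative f (at x) v)" for v
    by (rule Ck_on_cong[OF assms(1) _ assms(3)[of v]]) (simp add: frechet_derivative_at[OF assms(2)])
  with assms(2) show ?thesis by (auto simp: differentiable_def)
qed

text \<open>\<open>Ck_on (Suc k)\<close> speaks of the function itself only through
  differentiability, so lowering the order takes an induction. It serves derivative formulas in
  which a function reappears undifferentiated.\<close>

lemma Ck_on_SucD:
  "Ck_on (Suc k) S f \<Longrightarrow> Ck_on k S f"
proof (induction k arbitrary: f)
  case 0
  then show ?case
    by (auto intro!: continuous_at_imp_continuous_on differentiable_imp_continuous_within)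
next
  case (Suc k)
  show ?case
    unfolding Ck_on.simps(2)[of k]
    using Suc.prems Suc.IH unfolding Ck_on.simps(2)[of "Suc k"] by blast
qed

lemma Ck_on_const: "Ck_on k S (\<lambda>x. a)"
  by (induction k arbitrary: a) auto

lemma Ck_on_add:
  assumes S: "open S"
  shows "Ck_on k S f \<Longrightarrow> Ck_on k S g \<Longrightarrow> Ck_on k S (\<lambda>x. f x + g x)"
proof (induction k arbitrary: f g)
  case 0
  then show ?case by (simp add: continuous_on_add)
next
  case (Suc k)
  show ?case
    by (rule Ck_on_SucI[OF S has_derivative_add[OF Suc.prems[THEN Ck_on_has_derivative]]])
      (assumption+, intro Suc.IH Suc.prems[THEN Ck_on_derivative])
qed

lemma Ck_on_sum:
  assumes "open S" "\<And>i. i \<in> I \<Longrightarrow> Ck_on k S (f i)"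
  shows "Ck_on k S (\<lambda>x. \<Sum>i\<in>I. f i x)"
  using assms(2)
  by (induction I rule: infinite_finite_induct) (auto simp: Ck_on_const Ck_on_add[OF assms(1)])

lemma Ck_on_bounded_linear_compose:
  assumes S: "open S" and h: "bounded_linear h"
  shows "Ck_on k S f \<Longrightarrow> Ck_on k S (\<lambda>x. h (f x))"
proof (induction k arbitrary: f)
  case 0
  then show ?case using bounded_linear.continuous_on[OF h] by simp
next
  case (Suc k)
  show ?case
    by (rule Ck_on_SucI[OF S
          bounded_linear.has_derivative[OF h Suc.prems[THEN Ck_on_has_derivative]]])
      (assumption+, intro Suc.IH Suc.prems[THEN Ck_on_derivative])
qed

lemma Ck_on_bounded_linear:
  assumes "bounded_linear h"
  shows "Ck_on k S h"
proof (cases k)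
  case 0
  then show ?thesis using assms by (simp add: linear_continuous_on)
next
  case (Suc l)
  have "frechet_derivative h (at x) = h" for x
    using frechet_derivative_at bounded_linear_imp_has_derivative[OF assms] by metis
  then show ?thesis
    using Suc assms by (simp add: Ck_on_const bounded_linear_imp_differentiable)
qed

lemma Ck_on_scaleR:
  assumes S: "open S"
  shows "Ck_on k S f \<Longrightarrow> Ck_on k S g \<Longrightarrow> Ck_on k S (\<lambda>x. f x *\<^sub>R g x)"
proof (induction k arbitrary: f g)
  case 0
  then show ?case by (simp add: continuous_on_scaleR)
next
  case (Suc k)
  show ?case
    by (rule Ck_on_SucI[OF S has_derivative_scaleR[OF Suc.prems[THEN Ck_on_has_derivative]]])
      (assumption+, intro Ck_on_add[OF S] Suc.IH Suc.prems[THEN Ck_on_derivative] Suc.prems[THEN Ck_on_SucD])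
qed

lemma Ck_on_mult:
  fixes f g :: "'a::euclidean_space \<Rightarrow> real"
  assumes "open S" "Ck_on k S f" "Ck_on k S g"
  shows "Ck_on k S (\<lambda>x. f x * g x)"
  using Ck_on_scaleR[OF assms] by simp

lemma Ck_on_prod:
  fixes f :: "'i \<Rightarrow> 'a::euclidean_space \<Rightarrow> real"
  assumes "open S" "\<And>i. i \<in> I \<Longrightarrow> Ck_on k S (f i)"
  shows "Ck_on k S (\<lambda>x. \<Prod>i\<in>I. f i x)"
  using assms(2)
  by (induction I rule: infinite_finite_induct) (auto simp: Ck_on_const Ck_on_mult[OF assms(1)])

text \<open>The derivative \<open>- f' / f^2\<close> contains the reciprocal again, needed only to
  one order less, which is what the induction hypothesis provides; hence \<open>f\<close> stays
  fixed in the induction.\<close>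

lemma Ck_on_inverse:
  fixes f :: "'a::euclidean_space \<Rightarrow> real"
  assumes S: "open S" and nz: "\<And>x. x \<in> S \<Longrightarrow> f x \<noteq> 0"
  shows "Ck_on k S f \<Longrightarrow> Ck_on k S (\<lambda>x. inverse (f x))"
proof (induction k)
  case 0
  then show ?case using nz by (simp add: continuous_on_inverse)
next
  case (Suc k)
  have inv: "Ck_on k S (\<lambda>x. inverse (f x))"
    using Suc Ck_on_SucD by blast
  have D: "((\<lambda>x. inverse (f x)) has_derivative
      (\<lambda>v. (- 1) *\<^sub>R (inverse (f x) * frechet_derivative f (at x) v * inverse (f x)))) (at x)"
    if "x \<in> S" for x
    using Deriv.has_derivative_inverse[OF nz[OF that] Ck_on_has_derivative[OF Suc.prems that]]
    by simp
  show ?case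
    by (rule Ck_on_SucI[OF S D], assumption)
      (intro Ck_on_bounded_linear_compose[OF S bounded_linear_scaleR_right] Ck_on_mult[OF S] inv
        Ck_on_derivative[OF Suc.prems])
qed

text \<open>The derivative \<open>f' / (2 * sqrt f)\<close> again contains the function one order
  lower. Positivity keeps \<open>f\<close> away from 0, where the root is not
  differentiable.\<close>

lemma Ck_on_sqrt:
  fixes f :: "'a::euclidean_space \<Rightarrow> real"
  assumes S: "open S" and pos: "\<And>x. x \<in> S \<Longrightarrow> f x > 0"
  shows "Ck_on k S f \<Longrightarrow> Ck_on k S (\<lambda>x. sqrt (f x))"
proof (induction k)
  case 0
  then show ?case by (simp add: continuous_on_real_sqrt)
next
  case (Suc k)
  have sq: "Ck_on k S (\<lambda>x. sqrt (f x))"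
    using Suc Ck_on_SucD by blast
  have nz: "sqrt (f x) \<noteq> 0" if "x \<in> S" for x
    using pos[OF that] by simp
  have D: "((\<lambda>x. sqrt (f x)) has_derivative
      (\<lambda>v. frechet_derivative f (at x) v * (inverse (sqrt (f x)) * (1 / 2)))) (at x)"
    if "x \<in> S" for x
    using has_derivative_real_sqrt[OF pos[OF that] Ck_on_has_derivative[OF Suc.prems that]]
    by (simp add: field_simps)
  show ?case
    by (rule Ck_on_SucI[OF S D], assumption)
      (intro Ck_on_mult[OF S] Ck_on_inverse[OF S nz] sq Ck_on_const Ck_on_derivative[OF Suc.prems])
qed

lemma Ck_on_fst:
  fixes f :: "'a::euclidean_space \<Rightarrow> 'b::real_normed_vector"
  assumes S: "open S" "open U"
  shows "Ck_on k S f \<Longrightarrow> Ck_on k (S \<times> U) (\<lambda>z :: 'a \<times> 'c::euclidean_space. f (fst z))"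
proof (induction k arbitrary: f)
  case 0
  then show ?case by (auto intro!: continuous_on_compose2[of S f] continuous_intros)
next
  case (Suc k)
  have D: "((\<lambda>z. f (fst z)) has_derivative (\<lambda>w. frechet_derivative f (at (fst z)) (fst w))) (at z)"
    if "z \<in> S \<times> U" for z :: "'a \<times> 'c"
  proof -
    have "fst z \<in> S" using that by (simp add: mem_Times_iff)
    from has_derivative_compose[OF bounded_linear_imp_has_derivative[OF bounded_linear_fst]
        Ck_on_has_derivative[OF Suc.prems this]]
    show ?thesis .
  qed
  show ?case
    by (rule Ck_on_SucI[OF open_Times[OF S] D]) (assumption+, intro Suc.IH Suc.prems[THEN Ck_on_derivative])
qed

section \<open>Smoothness of all orders\<close>

lemma smooth_on_cong:
  "open S \<Longrightarrow> (\<And>x. x \<in> S \<Longrightarrow> f x = g x) \<Longrightarrow> smooth_on S f \<Longrightarrow> smooth_on S g"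
  unfolding smooth_on_def using Ck_on_cong by blast

lemma smooth_on_const: "smooth_on S (\<lambda>x. a)"
  by (simp add: smooth_on_def Ck_on_const)

lemma smooth_on_sum:
  "open S \<Longrightarrow> (\<And>i. i \<in> I \<Longrightarrow> smooth_on S (f i)) \<Longrightarrow> smooth_on S (\<lambda>x. \<Sum>i\<in>I. f i x)"
  by (simp add: smooth_on_def Ck_on_sum)

lemma smooth_on_prod:
  fixes f :: "'i \<Rightarrow> 'a::euclidean_space \<Rightarrow> real"
  shows "open S \<Longrightarrow> (\<And>i. i \<in> I \<Longrightarrow> smooth_on S (f i)) \<Longrightarrow> smooth_on S (\<lambda>x. \<Prod>i\<in>I. f i x)"
  by (simp add: smooth_on_def Ck_on_prod)

lemma smooth_on_scaleR:
  "open S \<Longrightarrow> smooth_on S f \<Longrightarrow> smooth_on S g \<Longrightarrow> smooth_on S (\<lambda>x. f x *\<^sub>R g x)"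
  by (simp add: smooth_on_def Ck_on_scaleR)

lemma smooth_on_mult:
  fixes f g :: "'a::euclidean_space \<Rightarrow> real"
  shows "open S \<Longrightarrow> smooth_on S f \<Longrightarrow> smooth_on S g \<Longrightarrow> smooth_on S (\<lambda>x. f x * g x)"
  by (simp add: smooth_on_def Ck_on_mult)

lemma smooth_on_add:
  "open S \<Longrightarrow> smooth_on S f \<Longrightarrow> smooth_on S g \<Longrightarrow> smooth_on S (\<lambda>x. f x + g x)"
  by (simp add: smooth_on_def Ck_on_add)

lemma smooth_on_bounded_linear_compose:
  "open S \<Longrightarrow> bounded_linear h \<Longrightarrow> smooth_on S f \<Longrightarrow> smooth_on S (\<lambda>x. h (f x))"
  by (simp add: smooth_on_def Ck_on_bounded_linear_compose)

lemma smooth_on_bounded_linear: "bounded_linear h \<Longrightarrow> smooth_on S h"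
  by (simp add: smooth_on_def Ck_on_bounded_linear)

lemma smooth_on_minus:
  "open S \<Longrightarrow> smooth_on S f \<Longrightarrow> smooth_on S (\<lambda>x. - f x)"
  using smooth_on_bounded_linear_compose[OF _ bounded_linear_minus[OF bounded_linear_ident]] .

lemma smooth_on_diff:
  "open S \<Longrightarrow> smooth_on S f \<Longrightarrow> smooth_on S g \<Longrightarrow> smooth_on S (\<lambda>x. f x - g x)"
  using smooth_on_add[OF _ _ smooth_on_minus, of S f g] by simp

lemma smooth_on_inverse:
  fixes f :: "'a::euclidean_space \<Rightarrow> real"
  shows "open S \<Longrightarrow> (\<And>x. x \<in> S \<Longrightarrow> f x \<noteq> 0) \<Longrightarrow> smooth_on S f \<Longrightarrow> smooth_on S (\<lambda>x. inverse (f x))"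
  by (simp add: smooth_on_def Ck_on_inverse)

lemma smooth_on_divide:
  fixes f g :: "'a::euclidean_space \<Rightarrow> real"
  shows "open S \<Longrightarrow> smooth_on S f \<Longrightarrow> smooth_on S g \<Longrightarrow> (\<And>x. x \<in> S \<Longrightarrow> g x \<noteq> 0) \<Longrightarrow>
    smooth_on S (\<lambda>x. f x / g x)"
  unfolding divide_inverse by (intro smooth_on_mult smooth_on_inverse)

lemma smooth_on_sqrt:
  fixes f :: "'a::euclidean_space \<Rightarrow> real"
  shows "open S \<Longrightarrow> (\<And>x. x \<in> S \<Longrightarrow> f x > 0) \<Longrightarrow> smooth_on S f \<Longrightarrow> smooth_on S (\<lambda>x. sqrt (f x))"
  by (simp add: smooth_on_def Ck_on_sqrt)

lemma smooth_on_fst: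
  "open S \<Longrightarrow> open U \<Longrightarrow> smooth_on S f \<Longrightarrow> smooth_on (S \<times> U) (\<lambda>z. f (fst z))"
  by (simp add: smooth_on_def Ck_on_fst)

lemma smooth_on_derivative:
  "smooth_on S f \<Longrightarrow> smooth_on S (\<lambda>x. frechet_derivative f (at x) v)"
  unfolding smooth_on_def using Ck_on_derivative by blast

lemma smooth_on_has_derivative:
  "smooth_on S f \<Longrightarrow> x \<in> S \<Longrightarrow> (f has_derivative frechet_derivative f (at x)) (at x)"
  unfolding smooth_on_def using Ck_on_has_derivative by blast

text \<open>Cramer's rule writes the entry as a quotient of determinants, which are polynomials in
  the entries of the matrices. The inverse metric in the Christoffel symbols calls for this.\<close>

lemma smooth_on_matrix_inv:
  fixes m :: "'a::euclidean_space \<Rightarrow> real^'n^'n"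
  assumes S: "open S" and inv: "\<And>x. x \<in> S \<Longrightarrow> invertible (m x)"
    and m: "\<And>i j. smooth_on S (\<lambda>x. m x $ i $ j)"
  shows "smooth_on S (\<lambda>x. matrix_inv (m x) $ k $ l)"
proof -
  \<comment> \<open>Not the adjugate: column \<open>k\<close> of \<open>m x\<close> is replaced by
    the unit vector of index \<open>l\<close>, which gives the numerator in Cramer's rule.\<close>
  define adj where "adj x = (\<chi> i j. if j = k then axis l 1 $ i else m x $ i $ j)" for x
  have smooth_det: "smooth_on S (\<lambda>x. det (b x))" if "\<And>i j. smooth_on S (\<lambda>x. b x $ i $ j)"
    for b :: "'a \<Rightarrow> real^'n^'n"
    unfolding det_def by (intro smooth_on_sum smooth_on_mult smooth_on_prod smooth_on_const S that)
  have adj: "smooth_on S (\<lambda>x. adj x $ i $ j)" for i j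
    using m[of i j] smooth_on_const[of S "axis l 1 $ i"] unfolding adj_def by (cases "j = k") auto
  have nz: "det (m x) \<noteq> 0" if "x \<in> S" for x
    using inv[OF that] by (simp add: invertible_det_nz)
  have "smooth_on S (\<lambda>x. det (adj x) / det (m x))"
    by (intro smooth_on_divide S smooth_det m adj nz)
  moreover have "det (adj x) / det (m x) = matrix_inv (m x) $ k $ l" if "x \<in> S" for x
  proof -
    have "m x ** matrix_inv (m x) = mat 1"
      using someI_ex[OF inv[OF that, unfolded invertible_def]] unfolding matrix_inv_def by blast
    then have "m x *v (matrix_inv (m x) *v axis l 1) = axis l 1"
      by (simp add: matrix_vector_mul_assoc)
    from arg_cong[OF iffD1[OF cramer[OF nz[OF that]] this], of "\<lambda>v. v $ k"]
    have "(matrix_inv (m x) *v axis l 1) $ k = det (adj x) / det (m x)"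
      by (simp add: adj_def)
    then show ?thesis
      by (simp add: matrix_vector_mult_basis column_def)
  qed
  ultimately show ?thesis
    by (rule smooth_on_cong[OF S, rotated])
qed

lemma smooth_on_vec:
  fixes f :: "'a::euclidean_space \<Rightarrow> real^'n"
  assumes S: "open S" and f: "\<And>k. smooth_on S (\<lambda>z. f z $ k)"
  shows "smooth_on S f"
proof (rule smooth_on_cong[OF S])
  show "smooth_on S (\<lambda>z. \<Sum>k\<in>UNIV. f z $ k *\<^sub>R (axis k 1 :: real^'n))"
    by (intro smooth_on_sum smooth_on_scaleR S f smooth_on_const)
  show "(\<Sum>k\<in>UNIV. f z $ k *\<^sub>R (axis k 1 :: real^'n)) = f z" for z
    using basis_expansion[of "f z"] by (simp add: scalar_mult_eq_scaleR)
qed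

lemma smooth_on_Pair:
  assumes "open S" "smooth_on S a" "smooth_on S b"
  shows "smooth_on S (\<lambda>z. (a z, b z))"
proof -
  have "smooth_on S (\<lambda>z. (a z, 0) + (0, b z))"
    by (intro smooth_on_add assms
        smooth_on_bounded_linear_compose[OF _ bounded_linear_Pair[OF bounded_linear_ident bounded_linear_zero]]
        smooth_on_bounded_linear_compose[OF _ bounded_linear_Pair[OF bounded_linear_zero bounded_linear_ident]])
  then show ?thesis by simp
qed

lemma smooth_on_vec_nth: "open S \<Longrightarrow> smooth_on S f \<Longrightarrow> smooth_on S (\<lambda>z. f z $ k)"
  by (rule smooth_on_bounded_linear_compose[OF _ bounded_linear_vec_nth])

section \<open>Symmetry of second derivatives\<close>

lemma frechet_derivative_eqI:
  "(f has_derivative f') (at x) \<Longrightarrow> frechet_derivative f (at x) = f'"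
  using frechet_derivative_at by (rule sym)

lemma has_real_derivative_along_line:
  fixes f :: "'a::real_normed_vector \<Rightarrow> real"
  assumes "(f has_derivative f') (at (x + t *\<^sub>R a))"
  shows "((\<lambda>s. f (x + s *\<^sub>R a)) has_real_derivative f' a) (at t)"
proof -
  have "((\<lambda>s. x + s *\<^sub>R a) has_derivative (\<lambda>s. s *\<^sub>R a)) (at t)"
    by (auto intro!: derivative_eq_intros)
  from has_derivative_compose[OF this assms] show ?thesis
    by (simp add: has_field_derivative_def linear_scale[OF has_derivative_linear[OF assms]]
        mult_commute_abs)
qed

text \<open>The mean value theorem is applied twice: in direction \<open>a\<close> to the increment
  of \<open>f\<close> along \<open>h *\<^sub>R b\<close>, then in direction \<open>b\<close> to the
  derivative so obtained. The second difference is symmetric in \<open>a\<close> and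
  \<open>b\<close>, its representation by a derivative a priori is not.\<close>

lemma second_difference:
  fixes f :: "'a::euclidean_space \<Rightarrow> real"
  assumes f: "Ck_on 2 S f" and r: "ball x r \<subseteq> S" and h: "h > 0" "h * (norm a + norm b) < r"
  shows "\<exists>y. dist x y \<le> h * (norm a + norm b) \<and>
    f (x + h *\<^sub>R a + h *\<^sub>R b) - f (x + h *\<^sub>R a) - f (x + h *\<^sub>R b) + f x =
      h * h * frechet_derivative (\<lambda>z. frechet_derivative f (at z) a) (at y) b"
proof -
  have f': "Ck_on (Suc (Suc 0)) S f"
    using f by (simp add: numeral_2_eq_2)
  have d: "dist x (x + s *\<^sub>R a + t *\<^sub>R b) \<le> h * (norm a + norm b)"
    if "0 \<le> s" "s \<le> h" "0 \<le> t" "t \<le> h" for s t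
  proof -
    have "x - (x + s *\<^sub>R a + t *\<^sub>R b) = - (s *\<^sub>R a + t *\<^sub>R b)"
      by simp
    then have "dist x (x + s *\<^sub>R a + t *\<^sub>R b) = norm (s *\<^sub>R a + t *\<^sub>R b)"
      by (simp only: dist_norm norm_minus_cancel)
    also have "\<dots> \<le> s * norm a + t * norm b"
      using norm_triangle_ineq[of "s *\<^sub>R a" "t *\<^sub>R b"] that by simp
    also have "\<dots> \<le> h * (norm a + norm b)"
      using that by (simp add: distrib_left add_mono mult_right_mono)
    finally show ?thesis .
  qed
  have S: "x + s *\<^sub>R a + t *\<^sub>R b \<in> S" if "0 \<le> s" "s \<le> h" "0 \<le> t" "t \<le> h" for s t
    using d[OF that] h(2) r by auto
  let ?D = "\<lambda>z. frechet_derivative f (at z) a"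
  have "\<exists>s>0. s < h \<and> (f (x + h *\<^sub>R a + h *\<^sub>R b) - f (x + h *\<^sub>R a)) -
      (f (x + 0 *\<^sub>R a + h *\<^sub>R b) - f (x + 0 *\<^sub>R a)) =
      (h - 0) * (?D (x + s *\<^sub>R a + h *\<^sub>R b) - ?D (x + s *\<^sub>R a))"
  proof (rule MVT2[OF h(1), of "\<lambda>s. f (x + s *\<^sub>R a + h *\<^sub>R b) - f (x + s *\<^sub>R a)"])
    fix s assume s: "0 \<le> s" "s \<le> h"
    have "((\<lambda>s. f (x + h *\<^sub>R b + s *\<^sub>R a)) has_real_derivative ?D (x + h *\<^sub>R b + s *\<^sub>R a)) (at s)"
      using S[OF s, of h] h(1)
      by (intro has_real_derivative_along_line Ck_on_has_derivative[OF f']) (simp add: add_ac)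
    moreover have "((\<lambda>s. f (x + s *\<^sub>R a)) has_real_derivative ?D (x + s *\<^sub>R a)) (at s)"
      using S[OF s, of 0] h(1)
      by (intro has_real_derivative_along_line Ck_on_has_derivative[OF f']) simp
    ultimately show "((\<lambda>s. f (x + s *\<^sub>R a + h *\<^sub>R b) - f (x + s *\<^sub>R a)) has_real_derivative
        ?D (x + s *\<^sub>R a + h *\<^sub>R b) - ?D (x + s *\<^sub>R a)) (at s)"
      using DERIV_diff by (simp add: add_ac) blast
  qed
  then obtain s where s: "0 < s" "s < h" and
    sD: "f (x + h *\<^sub>R a + h *\<^sub>R b) - f (x + h *\<^sub>R a) - f (x + h *\<^sub>R b) + f x =
      h * (?D (x + s *\<^sub>R a + h *\<^sub>R b) - ?D (x + s *\<^sub>R a))"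
    by (auto simp: algebra_simps)
  have "\<exists>t>0. t < h \<and> ?D (x + s *\<^sub>R a + h *\<^sub>R b) - ?D (x + s *\<^sub>R a + 0 *\<^sub>R b) =
      (h - 0) * frechet_derivative ?D (at (x + s *\<^sub>R a + t *\<^sub>R b)) b"
  proof (rule MVT2[OF h(1), of "\<lambda>t. ?D (x + s *\<^sub>R a + t *\<^sub>R b)"])
    fix t assume t: "0 \<le> t" "t \<le> h"
    show "((\<lambda>t. ?D (x + s *\<^sub>R a + t *\<^sub>R b)) has_real_derivative
        frechet_derivative ?D (at (x + s *\<^sub>R a + t *\<^sub>R b)) b) (at t)"
      using S[of s t] s t
      by (intro has_real_derivative_along_line Ck_on_has_derivative[OF Ck_on_derivative[OF f']]) simp
  qed
  then obtain t where t: "0 < t" "t < h" and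
    tD: "?D (x + s *\<^sub>R a + h *\<^sub>R b) - ?D (x + s *\<^sub>R a) =
      h * frechet_derivative ?D (at (x + s *\<^sub>R a + t *\<^sub>R b)) b"
    by auto
  show ?thesis
    using d[of s t] s t sD tD by (intro exI[of _ "x + s *\<^sub>R a + t *\<^sub>R b"]) simp
qed

text \<open>By \<open>second_difference\<close> the two orders of differentiation represent the same
  second difference, at two points close to \<open>x\<close>; continuity then forbids different
  values at \<open>x\<close>.\<close>

lemma symmetric_second_derivative_real:
  fixes f :: "'a::euclidean_space \<Rightarrow> real"
  assumes f: "Ck_on 2 S f" and S: "open S" and x: "x \<in> S"
  shows "frechet_derivative (\<lambda>z. frechet_derivative f (at z) a) (at x) b =
    frechet_derivative (\<lambda>z. frechet_derivative f (at z) b) (at x) a"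
proof (rule ccontr)
  define H where "H a b y = frechet_derivative (\<lambda>z. frechet_derivative f (at z) a) (at y) b" for a b y
  assume "\<not> ?thesis"
  \<comment> \<open>Half the gap: two deviations that are each smaller than this cannot close
    it.\<close>
  then have e0: "\<bar>H a b x - H b a x\<bar> / 2 > 0" (is "?e > 0")
    by (simp add: H_def)
  have cont: "\<exists>d>0. \<forall>y. dist x y < d \<longrightarrow> \<bar>H a b y - H a b x\<bar> < ?e" for a b
  proof -
    have "continuous_on S (H a b)"
      using f by (simp add: numeral_2_eq_2 H_def[abs_def])
    then have "isCont (H a b) x"
      using S x by (simp add: continuous_on_eq_continuous_at)
    then have "\<exists>d>0. \<forall>y. dist y x < d \<longrightarrow> dist (H a b y) (H a b x) < e"
      if "e > 0" for e
      using that unfolding continuous_at_eps_delta by blast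
    from this[OF e0] show ?thesis
      by (simp only: dist_real_def dist_commute[of x])
  qed
  obtain d1 where d1: "d1 > 0" "\<And>y. dist x y < d1 \<Longrightarrow> \<bar>H a b y - H a b x\<bar> < ?e"
    using cont[of a b] by blast
  obtain d2 where d2: "d2 > 0" "\<And>y. dist x y < d2 \<Longrightarrow> \<bar>H b a y - H b a x\<bar> < ?e"
    using cont[of b a] by blast
  obtain r where r: "r > 0" "ball x r \<subseteq> S"
    using S x openE by blast
  define m where "m = min r (min d1 d2)"
  \<comment> \<open>The summand 1 keeps the denominator positive when \<open>a\<close> and
    \<open>b\<close> vanish and makes the bound by \<open>m\<close> strict.\<close>
  define h where "h = m / (norm a + norm b + 1)"
  have m: "m > 0" using r d1 d2 by (simp add: m_def)
  then have h: "h > 0"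
    unfolding h_def by (intro divide_pos_pos) (auto intro: add_nonneg_pos)
  have "h * (norm a + norm b) < h * (norm a + norm b + 1)"
    using h by simp
  also have "\<dots> = m"
    unfolding h_def using norm_ge_zero[of a] norm_ge_zero[of b]
    by (simp add: add_nonneg_eq_0_iff)
  finally have hm: "h * (norm a + norm b) < m" .
  then have "h * (norm a + norm b) < r" "h * (norm b + norm a) < r"
    by (auto simp: m_def add.commute)
  note sd = second_difference[OF f r(2) h]
  obtain y where y: "dist x y \<le> h * (norm a + norm b)"
    "f (x + h *\<^sub>R a + h *\<^sub>R b) - f (x + h *\<^sub>R a) - f (x + h *\<^sub>R b) + f x = h * h * H a b y"
    using sd[of a b] \<open>h * (norm a + norm b) < r\<close> unfolding H_def by blast
  obtain z where z: "dist x z \<le> h * (norm b + norm a)"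
    "f (x + h *\<^sub>R b + h *\<^sub>R a) - f (x + h *\<^sub>R b) - f (x + h *\<^sub>R a) + f x = h * h * H b a z"
    using sd[of b a] \<open>h * (norm b + norm a) < r\<close> unfolding H_def by blast
  have "f (x + h *\<^sub>R b + h *\<^sub>R a) = f (x + h *\<^sub>R a + h *\<^sub>R b)"
    by (simp add: add_ac)
  then have "h * h * H a b y = h * h * H b a z"
    using y(2) z(2) by linarith
  then have "H a b y = H b a z"
    using h by simp
  moreover have "dist x y < d1" "dist x z < d2"
    using y(1) z(1) hm by (auto simp: m_def add.commute)
  ultimately show False
    using d1(2)[of y] d2(2)[of z] by argo
qed

lemma symmetric_second_derivative:
  fixes f :: "'a::euclidean_space \<Rightarrow> 'b::euclidean_space"
  assumes f: "Ck_on 2 S f" and S: "open S" and x: "x \<in> S"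
  shows "frechet_derivative (\<lambda>z. frechet_derivative f (at z) a) (at x) b =
    frechet_derivative (\<lambda>z. frechet_derivative f (at z) b) (at x) a"
proof (rule euclidean_eqI)
  fix i :: 'b
  note f' = f[unfolded numeral_2_eq_2]
  let ?g = "\<lambda>y. f y \<bullet> i"
  have g: "Ck_on 2 S ?g"
    by (rule Ck_on_bounded_linear_compose[OF S bounded_linear_inner_left f])
  have D: "frechet_derivative ?g (at y) = (\<lambda>v. frechet_derivative f (at y) v \<bullet> i)" if "y \<in> S" for y
    by (rule frechet_derivative_at[symmetric])
      (rule bounded_linear.has_derivative[OF bounded_linear_inner_left Ck_on_has_derivative[OF f' that]])
  have "frechet_derivative (\<lambda>z. frechet_derivative ?g (at z) v) (at x) w =
      frechet_derivative (\<lambda>z. frechet_derivative f (at z) v) (at x) w \<bullet> i" for v w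
  proof -
    have "((\<lambda>z. frechet_derivative f (at z) v \<bullet> i) has_derivative
        (\<lambda>w. frechet_derivative (\<lambda>z. frechet_derivative f (at z) v) (at x) w \<bullet> i)) (at x)"
      by (rule bounded_linear.has_derivative[OF bounded_linear_inner_left
            Ck_on_has_derivative[OF Ck_on_derivative[OF f'] x]])
    then have "((\<lambda>z. frechet_derivative ?g (at z) v) has_derivative
        (\<lambda>w. frechet_derivative (\<lambda>z. frechet_derivative f (at z) v) (at x) w \<bullet> i)) (at x)"
      by (rule has_derivative_transform_within_open[OF _ S x]) (simp add: D)
    from fun_cong[OF frechet_derivative_at[OF this], of w] show ?thesis by simp
  qed
  then show "frechet_derivative (\<lambda>z. frechet_derivative f (at z) a) (at x) b \<bullet> i =
      frechet_derivative (\<lambda>z. frechet_derivative f (at z) b) (at x) a \<bullet> i"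
    using symmetric_second_derivative_real[OF g S x, of a b] by simp
qed

section \<open>Coordinate expressions\<close>

lemma linear_axis_expansion:
  fixes f :: "real^'n \<Rightarrow> 'b::real_vector"
  assumes "linear f"
  shows "f v = (\<Sum>j\<in>UNIV. v $ j *\<^sub>R f (axis j 1))"
proof -
  have "v = (\<Sum>j\<in>UNIV. v $ j *\<^sub>R axis j 1)"
    using basis_expansion[of v] by (simp add: scalar_mult_eq_scaleR)
  from arg_cong[OF this, of f] show ?thesis
    by (simp only: linear_sum[OF assms] linear_scale[OF assms])
qed

text \<open>Turns index identities into identities of linear maps, one argument at a time.\<close>

lemma linear_eq_axis:
  fixes f h :: "real^'n \<Rightarrow> 'b::real_vector"
  assumes "linear f" "linear h" "\<And>i. f (axis i 1) = h (axis i 1)"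
  shows "f v = h v"
  by (simp only: linear_axis_expansion[OF assms(1), of v] linear_axis_expansion[OF assms(2), of v]
      assms(3))

text \<open>The metric in a chart as a bilinear form in the components; a change of charts then
  amounts to inserting Jacobians, without index sums.\<close>

definition metric_form ::
    "('a, real^'n) chart set \<Rightarrow> ('a \<Rightarrow> ('a, real^'n) tvec \<Rightarrow> ('a, real^'n) tvec \<Rightarrow> real)
      \<Rightarrow> ('a, real^'n) chart \<Rightarrow> real^'n \<Rightarrow> real^'n \<Rightarrow> real^'n \<Rightarrow> real"
  where "metric_form A g c x v w = v \<bullet> (metric_comp A g c x *v w)"

text \<open>Bilinear in each chart but not a tensor: under a change of charts a Hessian term
  appears.\<close>

definition christoffel_form ::
    "('a, real^'n) chart set \<Rightarrow> ('a \<Rightarrow> ('a, real^'n) tvec \<Rightarrow> ('a, real^'n) tvec \<Rightarrow> real)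
      \<Rightarrow> ('a, real^'n) chart \<Rightarrow> real^'n \<Rightarrow> real^'n \<Rightarrow> real^'n \<Rightarrow> real^'n"
  where "christoffel_form A g c x v w =
    (\<chi> k. \<Sum>i\<in>UNIV. \<Sum>j\<in>UNIV. v $ i * w $ j * christoffel A g c x i j k)"

definition transition_deriv ::
    "('a, 'e::euclidean_space) chart \<Rightarrow> ('a, 'e) chart \<Rightarrow> 'e \<Rightarrow> 'e \<Rightarrow> 'e"
  where "transition_deriv c d x = frechet_derivative (transition c d) (at x)"

text \<open>\<open>v\<close> is the direction of differentiation, \<open>w\<close> the vector to
  which the Jacobian is applied.\<close>

definition transition_hess ::
    "('a, 'e::euclidean_space) chart \<Rightarrow> ('a, 'e) chart \<Rightarrow> 'e \<Rightarrow> 'e \<Rightarrow> 'e \<Rightarrow> 'e"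
  where "transition_hess c d x v w = frechet_derivative (\<lambda>z. transition_deriv c d z w) (at x) v"

lemma linear_metric_form:
  "linear (\<lambda>v. metric_form A g c x v w)" "linear (metric_form A g c x v)"
  unfolding metric_form_def
  by (rule linearI; simp add: inner_add_left inner_add_right matrix_vector_right_distrib
      matrix_vector_mult_scaleR)+

lemma metric_form_axis: "metric_form A g c x (axis i 1) (axis j 1) = metric_comp A g c x $ i $ j"
  by (simp add: metric_form_def matrix_vector_mult_basis inner_axis' column_def)

lemma metric_form_eq_sum:
  "metric_form A g c x v w = (\<Sum>i\<in>UNIV. \<Sum>j\<in>UNIV. metric_comp A g c x $ i $ j * v $ i * w $ j)"
  by (simp add: metric_form_def inner_vec_def matrix_vector_mult_def sum_distrib_left mult_ac)

lemma linear_christoffel_form: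
  "linear (\<lambda>v. christoffel_form A g c x v w)" "linear (christoffel_form A g c x v)"
  unfolding christoffel_form_def
  by (rule linearI; simp add: vec_eq_iff algebra_simps sum.distrib sum_distrib_left)+

lemma christoffel_form_axis:
  "christoffel_form A g c x (axis i 1) (axis j 1) $ k = christoffel A g c x i j k"
proof -
  have "axis i 1 $ i' * axis j 1 $ j' * christoffel A g c x i' j' k =
      (if j' = j then if i' = i then christoffel A g c x i j k else 0 else 0)" for i' j'
    by (simp add: axis_def)
  then show ?thesis
    by (simp add: christoffel_form_def)
qed

lemma metric_form_sum_left:
  "metric_form A g c x v (axis j 1) = (\<Sum>l\<in>UNIV. v $ l * metric_comp A g c x $ l $ j)"
  by (simp add: metric_form_def inner_vec_def matrix_vector_mult_basis column_def)

lemma metric_form_sum_right: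
  "metric_form A g c x (axis i 1) w = (\<Sum>l\<in>UNIV. w $ l * metric_comp A g c x $ i $ l)"
  by (simp add: metric_form_def inner_axis' matrix_vector_mult_def mult.commute)

lemma christoffel_form_axis_right:
  "christoffel_form A g c x y (axis i 1) $ m = (\<Sum>a\<in>UNIV. y $ a * christoffel A g c x a i m)"
proof -
  have "y $ a * axis i 1 $ j * christoffel A g c x a j m =
      (if j = i then y $ a * christoffel A g c x a i m else 0)" for a j
    by (simp add: axis_def)
  then show ?thesis
    by (simp add: christoffel_form_def)
qed

lemma tangent_spaceD:
  assumes "v \<in> tangent_space A p"
  shows "c \<in> A \<Longrightarrow> d \<in> A \<Longrightarrow> p \<in> fst c \<Longrightarrow> p \<in> fst d \<Longrightarrow>
      v d = frechet_derivative (transition c d) (at (snd c p)) (v c)"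
    and "\<not> (c \<in> A \<and> p \<in> fst c) \<Longrightarrow> v c = 0"
  using assms unfolding tangent_space_def by blast+

lemma tangent_of_component:
  assumes v: "v \<in> tangent_space A p" and c: "c \<in> A" "p \<in> fst c"
  shows "tangent_of A c p (v c) = v"
proof
  fix d show "tangent_of A c p (v c) d = v d"
    unfolding tangent_of_def using tangent_spaceD(1)[OF v, of c d] tangent_spaceD(2)[OF v, of d] c by simp
qed

text \<open>The last assumption says directly that both charts name the same point. It stands in for
  the chart properties of a manifold, so the chain rule also serves the slit bundle.\<close>

lemma frechet_derivative_transition_chain:
  assumes cd: "(transition c d has_derivative P) (at x)"
    and de: "(transition d e has_derivative Q) (at (transition c d x))"
    and S: "open S" "x \<in> S" "\<And>z. z \<in> S \<Longrightarrow> chart_inv d (transition c d z) = chart_inv c z"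
  shows "frechet_derivative (transition c e) (at x) = (\<lambda>w. Q (P w))"
proof (rule frechet_derivative_eqI)
  show "(transition c e has_derivative (\<lambda>w. Q (P w))) (at x)"
    by (rule has_derivative_transform_within_open[OF has_derivative_compose[OF cd de] S(1,2)])
      (simp add: transition_def S(3)[unfolded transition_def comp_def])
qed

text \<open>The connection map of the Levi-Civita connection in coordinates: the vertical part of
  \<open>X\<close> along the horizontal distribution, as one vector.\<close>

definition delta_vec ::
    "('a, real^'n) chart set \<Rightarrow> ('a \<Rightarrow> ('a, real^'n) tvec \<Rightarrow> ('a, real^'n) tvec \<Rightarrow> real)
      \<Rightarrow> ('a, real^'n) chart \<Rightarrow> 'a \<times> ('a, real^'n) tvec \<Rightarrow> ('a, 'n) slit_tvec \<Rightarrow> real^'n"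
  where "delta_vec A g c u X = snd (X (slit_chart A c)) +
    christoffel_form A g c (coord_x c u) (coord_y c u) (fst (X (slit_chart A c)))"

lemma delta_y_eq: "delta_y A g c u i X = delta_vec A g c u X $ i"
  by (simp add: delta_y_def delta_vec_def dy_def dx_def christoffel_form_def Gamma_at_def mult_ac)

lemma norm_y_eq:
  "norm_y A g c u = sqrt (metric_form A g c (coord_x c u) (coord_y c u) (coord_y c u))"
  by (simp only: norm_y_def g_at_def metric_form_eq_sum)

lemma h_loc_eq:
  "h_loc A g c u X Y =
    2 * metric_form A g c (coord_x c u) (fst (X (slit_chart A c))) (fst (Y (slit_chart A c))) +
    2 / (norm_y A g c u)\<^sup>2 *
      metric_form A g c (coord_x c u) (delta_vec A g c u X) (delta_vec A g c u Y)"
proof -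
  have "(\<Sum>i\<in>UNIV. \<Sum>j\<in>UNIV. k * m i j * v i * w j) = k * (\<Sum>i\<in>UNIV. \<Sum>j\<in>UNIV. m i j * v i * w j)"
    for k :: real and m :: "'b::finite \<Rightarrow> 'b \<Rightarrow> real" and v w :: "'b \<Rightarrow> real"
    by (simp add: sum_distrib_left mult_ac)
  note 1 = this[of 2] and 2 = this[of "2 / (norm_y A g c u)\<^sup>2"]
  show ?thesis
    unfolding h_loc_def metric_form_eq_sum g_at_def delta_y_eq dx_def 1
    unfolding 2[symmetric] by simp
qed

lemma linear_Pair_zero: "linear (\<lambda>a. (a, 0))" "linear (\<lambda>b. (0, b))"
  by (rule linearI; simp)+

section \<open>The Christoffel symbols under a change of charts\<close>

context
  fixes T :: "'a topology"
    and A :: "('a, real^'n) chart set"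
    and g :: "'a \<Rightarrow> ('a, real^'n) tvec \<Rightarrow> ('a, real^'n) tvec \<Rightarrow> real"
  assumes M: "smooth_manifold T A"
    and g: "riemannian_metric A g"
begin

lemma metric_form_tangent_of:
  "c \<in> A \<Longrightarrow> p \<in> fst c \<Longrightarrow>
    metric_form A g c (snd c p) v w = g p (tangent_of A c p v) (tangent_of A c p w)"
  using metric_comp_apply[OF M g, of c p v w] by (simp only: metric_form_def)

lemma metric_form_sym:
  assumes "c \<in> A" "x \<in> snd c ` fst c"
  shows "metric_form A g c x v w = metric_form A g c x w v"
  unfolding metric_form_eq_sum
  by (subst sum.swap) (intro sum.cong refl, simp add: metric_comp_sym[OF M g assms])

lemma metric_form_pos:
  assumes c: "c \<in> A" "x \<in> snd c ` fst c" and v: "v \<noteq> 0"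
  shows "metric_form A g c x v v > 0"
proof -
  obtain p where p: "p \<in> fst c" "x = snd c p" using c by blast
  have "tangent_of A c p v \<noteq> 0"
    using tangent_of_self[OF M c(1) p(1), of v] v by auto
  then show ?thesis
    using riemannian_metricD(3)[OF g _ tangent_of_in_tangent_space[OF M c(1) p(1)]] c(1) p(1)
    unfolding p(2) metric_form_tangent_of[OF c(1) p(1)] by blast
qed

lemma smooth_on_metric_form:
  assumes c: "c \<in> A"
  shows "smooth_on (snd c ` fst c) (\<lambda>x. metric_form A g c x v w)"
proof (rule smooth_on_cong[OF smooth_manifold_chart(2)[OF M c]])
  show "smooth_on (snd c ` fst c) (\<lambda>x. g (chart_inv c x) (tangent_of A c (chart_inv c x) v)
                             (tangent_of A c (chart_inv c x) w))"
    using g c unfolding riemannian_metric_def by simp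
  fix x assume "x \<in> snd c ` fst c"
  then obtain p where p: "p \<in> fst c" "x = snd c p" by blast
  show "g (chart_inv c x) (tangent_of A c (chart_inv c x) v) (tangent_of A c (chart_inv c x) w) =
      metric_form A g c x v w"
    unfolding p(2) chart_inv_eq[OF M c p(1)] metric_form_tangent_of[OF c p(1)] ..
qed

lemma tangent_of_transition_deriv:
  assumes "c \<in> A" "d \<in> A" "p \<in> fst c" "p \<in> fst d"
  shows "tangent_of A d p (transition_deriv c d (snd c p) w) = tangent_of A c p w"
  using frechet_derivative_transition_comp[OF M assms(1,2) _ assms(3,4)]
  by (auto simp: tangent_of_def transition_deriv_def fun_eq_iff)

lemma transition_image:
  assumes "c \<in> A" "p \<in> fst c"
  shows "transition c d (snd c p) = snd d p"
  using chart_inv_eq[OF M assms] by (simp only: transition_def comp_apply)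

text \<open>Both sides evaluate \<open>g\<close> at one point on the same two tangent vectors,
  described in different charts.\<close>

lemma metric_form_transform:
  assumes c: "c \<in> A" and d: "d \<in> A" and x: "x \<in> snd c ` (fst c \<inter> fst d)"
  shows "metric_form A g c x v w =
    metric_form A g d (transition c d x) (transition_deriv c d x v) (transition_deriv c d x w)"
proof -
  obtain p where p: "p \<in> fst c" "p \<in> fst d" "x = snd c p" using x by blast
  show ?thesis
    unfolding p(3) transition_image[OF c p(1)]
    by (simp only: metric_form_tangent_of[OF c p(1)] metric_form_tangent_of[OF d p(2)]
        tangent_of_transition_deriv[OF c d p(1,2)])
qed

lemma christoffel_form_sym:
  assumes c: "c \<in> A" and x: "x \<in> snd c ` fst c"
  shows "christoffel_form A g c x v w = christoffel_form A g c x w v"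
proof -
  have "christoffel A g c x i j k = christoffel A g c x j i k" for i j k
    by (rule conjunct1[OF iffD2[OF christoffel_levi_civita[OF M g c x] refl], rule_format])
  then have "(\<Sum>i\<in>UNIV. \<Sum>j\<in>UNIV. v $ i * w $ j * christoffel A g c x i j k) =
      (\<Sum>i\<in>UNIV. \<Sum>j\<in>UNIV. w $ i * v $ j * christoffel A g c x i j k)" for k
    by (subst sum.swap) (intro sum.cong refl, simp)
  then show ?thesis
    by (simp only: christoffel_form_def)
qed

section \<open>Metric compatibility and uniqueness in bilinear form\<close>

lemma metric_form_has_derivative:
  assumes "c \<in> A" "x \<in> snd c ` fst c"
  shows "((\<lambda>x. metric_form A g c x a b) has_derivative
    frechet_derivative (\<lambda>x. metric_form A g c x a b) (at x)) (at x)"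
  by (rule smooth_on_has_derivative[OF smooth_on_metric_form[OF assms(1)] assms(2)])

lemma linear_derivative_metric_form:
  assumes c: "c \<in> A" "x \<in> snd c ` fst c"
  shows "linear (\<lambda>a. frechet_derivative (\<lambda>x. metric_form A g c x a b) (at x) v)"
    and "linear (\<lambda>b. frechet_derivative (\<lambda>x. metric_form A g c x a b) (at x) v)"
    and "linear (frechet_derivative (\<lambda>x. metric_form A g c x a b) (at x))"
proof -
  note D = metric_form_has_derivative[OF c]
  note eq = frechet_derivative_eqI[OF has_derivative_add[OF D D]]
    frechet_derivative_eqI[OF has_derivative_scaleR_right[OF D]]
  show "linear (\<lambda>a. frechet_derivative (\<lambda>x. metric_form A g c x a b) (at x) v)"
    by (rule linearI) (simp_all only: linear_add[OF linear_metric_form(1)]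
        linear_scale[OF linear_metric_form(1)] eq)
  show "linear (\<lambda>b. frechet_derivative (\<lambda>x. metric_form A g c x a b) (at x) v)"
    by (rule linearI) (simp_all only: linear_add[OF linear_metric_form(2)]
        linear_scale[OF linear_metric_form(2)] eq)
  show "linear (frechet_derivative (\<lambda>x. metric_form A g c x a b) (at x))"
    by (rule has_derivative_linear[OF D])
qed

text \<open>This is the vanishing covariant derivative of the metric. On basis vectors it is the
  index formula in \<open>christoffel_levi_civita\<close>; linearity extends it to all
  \<open>v\<close>, then \<open>a\<close>, then \<open>b\<close>.\<close>

lemma christoffel_form_metric:
  assumes c: "c \<in> A" "x \<in> snd c ` fst c"
  shows "frechet_derivative (\<lambda>x. metric_form A g c x a b) (at x) v =
    metric_form A g c x (christoffel_form A g c x v a) b +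
    metric_form A g c x a (christoffel_form A g c x v b)"
proof -
  note lin = linear_derivative_metric_form[OF c]
    linear_compose[OF linear_christoffel_form(1) linear_metric_form(1), unfolded o_def]
    linear_compose[OF linear_christoffel_form(2) linear_metric_form(1), unfolded o_def]
    linear_compose[OF linear_christoffel_form(1) linear_metric_form(2), unfolded o_def]
    linear_compose[OF linear_christoffel_form(2) linear_metric_form(2), unfolded o_def]
    linear_metric_form
  have "\<forall>i j k. partial k (\<lambda>x. metric_comp A g c x $ i $ j) x =
         (\<Sum>l\<in>UNIV. christoffel A g c x k i l * metric_comp A g c x $ l $ j +
                   christoffel A g c x k j l * metric_comp A g c x $ i $ l)"
    by (rule conjunct2[OF iffD2[OF christoffel_levi_civita[OF M g c] refl]])
  then have ax: "frechet_derivative (\<lambda>x. metric_form A g c x (axis i 1) (axis j 1)) (at x) (axis k 1) =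
    metric_form A g c x (christoffel_form A g c x (axis k 1) (axis i 1)) (axis j 1) +
    metric_form A g c x (axis i 1) (christoffel_form A g c x (axis k 1) (axis j 1))" for i j k
    by (simp add: metric_form_axis metric_form_sum_left[of A g c x]
        metric_form_sum_right[of A g c x]
        christoffel_form_axis partial_def sum.distrib)
  have ax2: "frechet_derivative (\<lambda>x. metric_form A g c x (axis i 1) (axis j 1)) (at x) v =
    metric_form A g c x (christoffel_form A g c x v (axis i 1)) (axis j 1) +
    metric_form A g c x (axis i 1) (christoffel_form A g c x v (axis j 1))" for i j
    by (rule linear_eq_axis[where
          f = "frechet_derivative (\<lambda>x. metric_form A g c x (axis i 1) (axis j 1)) (at x)" and
          h = "\<lambda>v. metric_form A g c x (christoffel_form A g c x v (axis i 1)) (axis j 1) +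
            metric_form A g c x (axis i 1) (christoffel_form A g c x v (axis j 1))"])
      (rule lin(3) ax linear_compose_add lin(4-))+
  have ax3: "frechet_derivative (\<lambda>x. metric_form A g c x a (axis j 1)) (at x) v =
    metric_form A g c x (christoffel_form A g c x v a) (axis j 1) +
    metric_form A g c x a (christoffel_form A g c x v (axis j 1))" for j
    by (rule linear_eq_axis[where
          f = "\<lambda>a. frechet_derivative (\<lambda>x. metric_form A g c x a (axis j 1)) (at x) v" and
          h = "\<lambda>a. metric_form A g c x (christoffel_form A g c x v a) (axis j 1) +
            metric_form A g c x a (christoffel_form A g c x v (axis j 1))"])
      (rule lin(1) ax2 linear_compose_add lin(4-))+
  show ?thesis
    by (rule linear_eq_axis[where
          f = "\<lambda>b. frechet_derivative (\<lambda>x. metric_form A g c x a b) (at x) v" and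
          h = "\<lambda>b. metric_form A g c x (christoffel_form A g c x v a) b +
            metric_form A g c x a (christoffel_form A g c x v b)"])
      (rule lin(2) ax3 linear_compose_add lin(4-))+
qed

text \<open>The converse part of \<open>christoffel_levi_civita\<close> without indices. It
  identifies the symbols by their properties alone, which spares an index computation when charts
  change.\<close>

lemma christoffel_form_unique:
  fixes K :: "real^'n \<Rightarrow> real^'n \<Rightarrow> real^'n"
  assumes c: "c \<in> A" "x \<in> snd c ` fst c"
    and lin: "\<And>w. linear (\<lambda>v. K v w)" "\<And>v. linear (K v)"
    and sym: "\<And>v w. K v w = K w v"
    and met: "\<And>v a b. frechet_derivative (\<lambda>x. metric_form A g c x a b) (at x) v =
      metric_form A g c x (K v a) b + metric_form A g c x a (K v b)"
  shows "K v w = christoffel_form A g c x v w"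
proof -
  define G where "G i j k = K (axis i 1) (axis j 1) $ k" for i j k
  have Gsym: "G i j k = G j i k" for i j k
    unfolding G_def using sym[of "axis i 1" "axis j 1"] by simp
  have Gmet: "partial k (\<lambda>x. metric_comp A g c x $ i $ j) x =
     (\<Sum>l\<in>UNIV. G k i l * metric_comp A g c x $ l $ j + G k j l * metric_comp A g c x $ i $ l)" for i j k
    using met[of "axis i 1" "axis j 1" "axis k 1"]
    by (simp add: metric_form_axis metric_form_sum_left[of A g c x]
        metric_form_sum_right[of A g c x] G_def
        partial_def sum.distrib)
  have "G = christoffel A g c x"
    by (rule iffD1[OF christoffel_levi_civita[OF M g c]], intro conjI allI)
      (rule Gsym, rule Gmet)
  then have ax: "K (axis i 1) (axis j 1) = christoffel_form A g c x (axis i 1) (axis j 1)" for i j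
    by (simp add: vec_eq_iff christoffel_form_axis G_def[symmetric])
  have ax2: "K v (axis j 1) = christoffel_form A g c x v (axis j 1)" for j
    by (rule linear_eq_axis[where f = "\<lambda>v. K v (axis j 1)" and
          h = "\<lambda>v. christoffel_form A g c x v (axis j 1)"])
      (rule lin linear_christoffel_form ax)+
  show ?thesis
    by (rule linear_eq_axis[where f = "K v" and h = "christoffel_form A g c x v"])
      (rule lin linear_christoffel_form ax2)+
qed

section \<open>Jacobian and Hessian of a change of charts\<close>

lemma transition_deriv_has_derivative:
  assumes c: "c \<in> A" and d: "d \<in> A" and x: "x \<in> snd c ` (fst c \<inter> fst d)"
  shows "(transition c d has_derivative transition_deriv c d x) (at x)"
  using transition_has_derivative[OF M c d] x unfolding transition_deriv_def by blast

lemma transition_hess_has_derivative: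
  assumes c: "c \<in> A" and d: "d \<in> A" and x: "x \<in> snd c ` (fst c \<inter> fst d)"
  shows "((\<lambda>z. transition_deriv c d z w) has_derivative (\<lambda>v. transition_hess c d x v w)) (at x)"
proof -
  have "smooth_on (snd c ` (fst c \<inter> fst d)) (transition c d)"
    using M c d unfolding smooth_manifold_def by simp
  from smooth_on_has_derivative[OF smooth_on_derivative[OF this] x]
  show ?thesis unfolding transition_hess_def transition_deriv_def .
qed

lemma transition_hess_sym:
  assumes c: "c \<in> A" and d: "d \<in> A" and x: "x \<in> snd c ` (fst c \<inter> fst d)"
  shows "transition_hess c d x v w = transition_hess c d x w v"
proof -
  have "smooth_on (snd c ` (fst c \<inter> fst d)) (transition c d)"
    using M c d unfolding smooth_manifold_def by simp
  then have "Ck_on 2 (snd c ` (fst c \<inter> fst d)) (transition c d)"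
    unfolding smooth_on_def by (rule spec)
  from symmetric_second_derivative[OF this chart_open_image[OF M c d] x]
  show ?thesis unfolding transition_hess_def transition_deriv_def .
qed

text \<open>Linearity in the direction of differentiation belongs to the derivative; the other
  argument inherits it through symmetry.\<close>

lemma linear_transition_hess:
  assumes "c \<in> A" "d \<in> A" "x \<in> snd c ` (fst c \<inter> fst d)"
  shows "linear (\<lambda>v. transition_hess c d x v w)" "linear (transition_hess c d x w)"
proof -
  show *: "linear (\<lambda>v. transition_hess c d x v w)" for w
    by (rule has_derivative_linear[OF transition_hess_has_derivative[OF assms]])
  then show "linear (transition_hess c d x w)"
    by (subst transition_hess_sym[OF assms, abs_def])
qed

lemma transition_deriv_inverse:
  assumes c: "c \<in> A" and d: "d \<in> A" and x: "x \<in> snd c ` (fst c \<inter> fst d)"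
  shows "transition_deriv d c (transition c d x) (transition_deriv c d x w) = w"
proof -
  obtain p where p: "p \<in> fst c" "p \<in> fst d" "x = snd c p" using x by blast
  show ?thesis
    using frechet_derivative_transition_comp[OF M c d c p(1,2,1), of w]
      frechet_derivative_transition_self[OF M c p(1), of w]
    unfolding p(3) transition_image[OF c p(1)] transition_deriv_def by simp
qed

lemma transition_overlap:
  assumes c: "c \<in> A" and x: "x \<in> snd c ` (fst c \<inter> fst d)"
  shows "transition c d x \<in> snd d ` (fst d \<inter> fst c)"
proof -
  obtain p where p: "p \<in> fst c" "p \<in> fst d" "x = snd c p" using x by blast
  then show ?thesis
    unfolding p(3) transition_image[OF c p(1)] by blast
qed

lemma transition_inverse:
  assumes c: "c \<in> A" and d: "d \<in> A" and x: "x \<in> snd c ` (fst c \<inter> fst d)"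
  shows "transition d c (transition c d x) = x"
proof -
  obtain p where p: "p \<in> fst c" "p \<in> fst d" "x = snd c p" using x by blast
  show ?thesis
    unfolding p(3) transition_image[OF c p(1)] transition_image[OF d p(2)] ..
qed

text \<open>Product rule for a bilinear form with varying coefficients: one term for the moving base
  point and one for each argument. The inner map \<open>f\<close> is there because the rule is to
  differentiate the transformation law of the metric.\<close>

lemma has_derivative_metric_form_compose:
  assumes d: "d \<in> A" "f x \<in> snd d ` fst d"
    and f: "(f has_derivative f') (at x)"
    and u: "(u has_derivative u') (at x)"
    and w: "(w has_derivative w') (at x)"
  shows "((\<lambda>z. metric_form A g d (f z) (u z) (w z)) has_derivative
    (\<lambda>h. frechet_derivative (\<lambda>y. metric_form A g d y (u x) (w x)) (at (f x)) (f' h) +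
      metric_form A g d (f x) (u' h) (w x) + metric_form A g d (f x) (u x) (w' h))) (at x)"
proof -
  let ?m = "\<lambda>y i j. metric_comp A g d y $ i $ j"
  define m' where "m' i j = frechet_derivative (\<lambda>y. ?m y i j) (at (f x))" for i j
  have m': "((\<lambda>y. ?m y i j) has_derivative m' i j) (at (f x))" for i j
    using metric_form_has_derivative[OF d, of "axis i 1" "axis j 1"]
    unfolding metric_form_axis m'_def .
  have "((\<lambda>y. \<Sum>i\<in>UNIV. \<Sum>j\<in>UNIV. ?m y i j * u x $ i * w x $ j) has_derivative
      (\<lambda>k. \<Sum>i\<in>UNIV. \<Sum>j\<in>UNIV. m' i j k * u x $ i * w x $ j)) (at (f x))"
    by (intro has_derivative_sum has_derivative_mult_left m')
  then have fd: "frechet_derivative (\<lambda>y. metric_form A g d y (u x) (w x)) (at (f x)) k =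
      (\<Sum>i\<in>UNIV. \<Sum>j\<in>UNIV. m' i j k * u x $ i * w x $ j)" for k
    unfolding metric_form_eq_sum by (simp only: frechet_derivative_eqI)
  have "((\<lambda>z. \<Sum>i\<in>UNIV. \<Sum>j\<in>UNIV. ?m (f z) i j * u z $ i * w z $ j) has_derivative
      (\<lambda>h. \<Sum>i\<in>UNIV. \<Sum>j\<in>UNIV. (?m (f x) i j * u x $ i) * w' h $ j +
        (?m (f x) i j * u' h $ i + m' i j (f' h) * u x $ i) * w x $ j)) (at x)"
    by (intro has_derivative_sum has_derivative_mult has_derivative_compose[OF f m']
        bounded_linear.has_derivative[OF bounded_linear_vec_nth u]
        bounded_linear.has_derivative[OF bounded_linear_vec_nth w])
  then show ?thesis
    unfolding fd unfolding metric_form_eq_sum sum.distrib[symmetric]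
    by (rule has_derivative_eq_rhs) (simp add: algebra_simps)
qed

lemma christoffel_form_transform:
  assumes c: "c \<in> A" and d: "d \<in> A" and x: "x \<in> snd c ` (fst c \<inter> fst d)"
  shows "transition_deriv c d x (christoffel_form A g c x v w) = transition_hess c d x v w +
    christoffel_form A g d (transition c d x) (transition_deriv c d x v) (transition_deriv c d x w)"
proof -
  let ?t = "transition c d" and ?P = "transition_deriv c d x"
    and ?Q = "transition_deriv d c (transition c d x)" and ?B = "transition_hess c d x"
  let ?G = "\<lambda>v w. christoffel_form A g d (?t x) (?P v) (?P w)"
  \<comment> \<open>the Christoffel symbols of \<open>d\<close> pulled back to \<open>c\<close>\<close>
  define K where "K v w = ?Q (?B v w + ?G v w)" for v w
  note tx = transition_overlap[OF c x]
  have xc: "x \<in> snd c ` fst c" and xd: "?t x \<in> snd d ` fst d"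
    using x tx by blast+
  have P: "linear ?P"
    by (rule has_derivative_linear[OF transition_deriv_has_derivative[OF c d x]])
  have Q: "linear ?Q"
    by (rule has_derivative_linear[OF transition_deriv_has_derivative[OF d c tx]])
  have PQ: "?P (?Q w) = w" for w
    using transition_deriv_inverse[OF d c tx, of w] unfolding transition_inverse[OF c d x] .
  have PK: "?P (K v w) = ?B v w + ?G v w" for v w
    unfolding K_def by (rule PQ)
  have lin: "linear (\<lambda>v. K v w)" "linear (K v)" for v w
  proof -
    have "linear (\<lambda>v. ?B v w + ?G v w)"
      using linear_compose[OF P linear_christoffel_form(1), unfolded o_def]
      by (intro linear_compose_add linear_transition_hess(1)[OF c d x])
    from linear_compose[OF this Q, unfolded o_def] show "linear (\<lambda>v. K v w)"
      unfolding K_def .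
    have "linear (\<lambda>w. ?B v w + ?G v w)"
      using linear_compose[OF P linear_christoffel_form(2), unfolded o_def]
      by (intro linear_compose_add linear_transition_hess(2)[OF c d x])
    from linear_compose[OF this Q, unfolded o_def] show "linear (K v)"
      unfolding K_def[abs_def] .
  qed
  have sym: "K v w = K w v" for v w
    unfolding K_def
    by (simp only: transition_hess_sym[OF c d x, of v w]
        christoffel_form_sym[OF d xd, of "?P v" "?P w"])
  have met: "frechet_derivative (\<lambda>x. metric_form A g c x a b) (at x) v =
      metric_form A g c x (K v a) b + metric_form A g c x a (K v b)" for v a b
  proof -
    let ?m = "metric_form A g d (?t x)"
    have "((\<lambda>z. metric_form A g d (?t z) (transition_deriv c d z a) (transition_deriv c d z b))
        has_derivative (\<lambda>v. frechet_derivative (\<lambda>y. metric_form A g d y (?P a) (?P b)) (at (?t x)) (?P v)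
          + ?m (?B v a) (?P b) + ?m (?P a) (?B v b))) (at x)"
      by (rule has_derivative_metric_form_compose[OF d(1) xd
            transition_deriv_has_derivative[OF c d x] transition_hess_has_derivative[OF c d x]
            transition_hess_has_derivative[OF c d x]])
    then have "((\<lambda>z. metric_form A g c z a b)
        has_derivative (\<lambda>v. frechet_derivative (\<lambda>y. metric_form A g d y (?P a) (?P b)) (at (?t x)) (?P v)
          + ?m (?B v a) (?P b) + ?m (?P a) (?B v b))) (at x)"
      by (rule has_derivative_transform_within_open[OF _ chart_open_image[OF M c d] x])
        (rule metric_form_transform[OF c d, symmetric])
    then have "frechet_derivative (\<lambda>z. metric_form A g c z a b) (at x) v =
        ?m (?G v a) (?P b) + ?m (?P a) (?G v b) + ?m (?B v a) (?P b) + ?m (?P a) (?B v b)"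
      by (simp only: frechet_derivative_eqI christoffel_form_metric[OF d xd])
    \<comment> \<open>Sorted by slot, Hessian and Christoffel terms add up to
      \<open>?P (K v a)\<close> and \<open>?P (K v b)\<close>; this is what dictates the form of
      \<open>K\<close>.\<close>
    also have "\<dots> = ?m (?P (K v a)) (?P b) + ?m (?P a) (?P (K v b))"
      unfolding PK linear_add[OF linear_metric_form(1)] linear_add[OF linear_metric_form(2)]
      by (simp only: add_ac)
    also have "\<dots> = metric_form A g c x (K v a) b + metric_form A g c x a (K v b)"
      by (simp only: metric_form_transform[OF c d x])
    finally show ?thesis .
  qed
  have "K v w = christoffel_form A g c x v w"
    by (rule christoffel_form_unique[OF c xc lin sym met])
  then show ?thesis
    using PK[of v w] by simp
qed

section \<open>Charts and tangent vectors of the slit tangent bundle\<close>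

lemma slit_chart_mem:
  "u \<in> fst (slit_chart A c) \<longleftrightarrow> fst u \<in> fst c \<and> snd u \<in> tangent_space A (fst u) \<and> snd u \<noteq> 0"
  by (auto simp: slit_chart_def)

lemma slit_chart_map: "snd (slit_chart A c) u = (coord_x c u, coord_y c u)"
  by (simp add: slit_chart_def coord_x_def coord_y_def split: prod.splits)

text \<open>A tangent vector is recovered from its component in one chart around its base point, so
  this component cannot vanish unless the vector does.\<close>

lemma coord_y_nonzero:
  assumes c: "c \<in> A" and u: "u \<in> fst (slit_chart A c)"
  shows "coord_y c u \<noteq> 0"
proof
  assume 0: "coord_y c u = 0"
  have "snd u = tangent_of A c (fst u) 0"
    using tangent_of_component[of "snd u" A "fst u" c] u c 0 unfolding slit_chart_mem coord_y_def
    by simp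
  also have "\<dots> = 0"
    using u unfolding slit_chart_mem by (intro linear_0 tangent_of_linear[OF M c]) simp
  finally show False
    using u unfolding slit_chart_mem by simp
qed

lemma slit_chart_inj:
  assumes c: "c \<in> A"
  shows "inj_on (snd (slit_chart A c)) (fst (slit_chart A c))"
proof (rule inj_onI)
  fix u u'
  assume u: "u \<in> fst (slit_chart A c)" "u' \<in> fst (slit_chart A c)"
    and eq: "snd (slit_chart A c) u = snd (slit_chart A c) u'"
  have p: "fst u = fst u'"
    using eq u inj_onD[OF smooth_manifold_chart(1)[OF M c], of "fst u" "fst u'"]
    unfolding slit_chart_map slit_chart_mem coord_x_def by simp
  have "snd u = tangent_of A c (fst u) (coord_y c u)"
    using u(1) c unfolding slit_chart_mem coord_y_def by (intro tangent_of_component[symmetric]) auto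
  also have "\<dots> = tangent_of A c (fst u') (coord_y c u')"
    using eq p unfolding slit_chart_map by simp
  also have "\<dots> = snd u'"
    using u(2) c unfolding slit_chart_mem coord_y_def by (intro tangent_of_component) auto
  finally show "u = u'" using p by (simp add: prod_eq_iff)
qed

lemma chart_inv_slit_chart:
  "c \<in> A \<Longrightarrow> u \<in> fst (slit_chart A c) \<Longrightarrow> chart_inv (slit_chart A c) (snd (slit_chart A c) u) = u"
  unfolding chart_inv_def by (rule inv_into_f_f[OF slit_chart_inj])

text \<open>Every non-zero \<open>y\<close> is the component of a tangent vector, namely of
  \<open>tangent_of A c p y\<close>, so the image is a full product. Openness of the overlaps is
  read off from this form.\<close>

lemma slit_chart_overlap:
  assumes c: "c \<in> A" and d: "d \<in> A"
  shows "snd (slit_chart A c) ` (fst (slit_chart A c) \<inter> fst (slit_chart A d)) =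
    (snd c ` (fst c \<inter> fst d)) \<times> (- {0})"
proof (intro subset_antisym subsetI)
  fix z assume "z \<in> snd (slit_chart A c) ` (fst (slit_chart A c) \<inter> fst (slit_chart A d))"
  then obtain u where u: "u \<in> fst (slit_chart A c)" "u \<in> fst (slit_chart A d)"
    "z = (coord_x c u, coord_y c u)"
    unfolding slit_chart_map by blast
  then show "z \<in> (snd c ` (fst c \<inter> fst d)) \<times> (- {0})"
    using coord_y_nonzero[OF c u(1)] unfolding slit_chart_mem by (simp add: coord_x_def)
next
  fix z :: "(real^'n) \<times> (real^'n)"
  assume "z \<in> (snd c ` (fst c \<inter> fst d)) \<times> (- {0})"
  then obtain p where p: "p \<in> fst c" "p \<in> fst d" "fst z = snd c p" and nz: "snd z \<noteq> 0"
    by (auto simp: mem_Times_iff)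
  let ?v = "tangent_of A c p (snd z)"
  have vc: "?v c = snd z"
    by (rule tangent_of_self[OF M c p(1)])
  with nz have "?v \<noteq> 0" by auto
  then have "(p, ?v) \<in> fst (slit_chart A c) \<inter> fst (slit_chart A d)"
    using p tangent_of_in_tangent_space[OF M c p(1)] unfolding Int_iff slit_chart_mem by simp
  moreover have "z = snd (slit_chart A c) (p, ?v)"
    unfolding slit_chart_map using p(3) vc by (simp add: coord_x_def coord_y_def prod_eq_iff)
  ultimately show "z \<in> snd (slit_chart A c) ` (fst (slit_chart A c) \<inter> fst (slit_chart A d))"
    by (rule rev_image_eqI)
qed

lemma slit_chart_image:
  "c \<in> A \<Longrightarrow> snd (slit_chart A c) ` fst (slit_chart A c) = (snd c ` fst c) \<times> (- {0})"
  using slit_chart_overlap[of c c] by simp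

lemma slit_transition_image:
  assumes "c \<in> A" "u \<in> fst (slit_chart A c)"
  shows "transition (slit_chart A c) d' (snd (slit_chart A c) u) = snd d' u"
  by (simp add: transition_def chart_inv_slit_chart[OF assms])

section \<open>Points and tangent vectors under a change of induced charts\<close>

lemma coord_x_mem:
  assumes "u \<in> fst (slit_chart A c)" "u \<in> fst (slit_chart A d)"
  shows "coord_x c u \<in> snd c ` (fst c \<inter> fst d)"
  using assms unfolding slit_chart_mem coord_x_def by simp

lemma coord_transform:
  assumes c: "c \<in> A" and d: "d \<in> A"
    and u: "u \<in> fst (slit_chart A c)" "u \<in> fst (slit_chart A d)"
  shows "coord_x d u = transition c d (coord_x c u)"
    and "coord_y d u = transition_deriv c d (coord_x c u) (coord_y c u)"
proof -
  show "coord_x d u = transition c d (coord_x c u)"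
    using u unfolding slit_chart_mem coord_x_def by (simp add: transition_image[OF c])
  show "coord_y d u = transition_deriv c d (coord_x c u) (coord_y c u)"
    using u unfolding slit_chart_mem coord_y_def coord_x_def transition_deriv_def
    by (intro tangent_spaceD(1)[where A = A] c d) simp_all
qed

text \<open>The Hessian term comes from differentiating \<open>Dt(x)\<close> in
  \<open>Dt(x) y\<close>. The derivative is block triangular, with the Jacobian of the base in both
  diagonal blocks.\<close>

lemma slit_transition_has_derivative:
  assumes c: "c \<in> A" and d: "d \<in> A"
    and u: "u \<in> fst (slit_chart A c)" "u \<in> fst (slit_chart A d)"
  shows "(transition (slit_chart A c) (slit_chart A d) has_derivative
    (\<lambda>w. (transition_deriv c d (coord_x c u) (fst w),
      transition_deriv c d (coord_x c u) (snd w) +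
      transition_hess c d (coord_x c u) (fst w) (coord_y c u))))
    (at (snd (slit_chart A c) u))"
proof (rule has_derivative_transform_within_open)
  let ?x = "coord_x c u" and ?y = "coord_y c u"
  let ?P = "transition_deriv c d" and ?S = "snd c ` (fst c \<inter> fst d)"
  note x = coord_x_mem[OF u]
  have linP: "linear (?P z)" if "z \<in> ?S" for z
    by (rule has_derivative_linear[OF transition_deriv_has_derivative[OF c d that]])
  have expP: "?P ?x v = (\<Sum>j\<in>UNIV. v $ j *\<^sub>R ?P ?x (axis j 1))" for v
    by (rule linear_axis_expansion[OF linP[OF x]])
  have expB: "transition_hess c d ?x v ?y = (\<Sum>j\<in>UNIV. ?y $ j *\<^sub>R transition_hess c d ?x v (axis j 1))" for v
    by (rule linear_axis_expansion[OF linear_transition_hess(2)[OF c d x]])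
  have fstx: "(fst has_derivative fst) (at (?x, ?y))" and sndy: "(snd has_derivative snd) (at (?x, ?y))"
    by (rule bounded_linear_imp_has_derivative bounded_linear_fst bounded_linear_snd)+
  \<comment> \<open>The Jacobian is known to be differentiable in \<open>x\<close> only when applied
    to a fixed vector; expanding the fibre coordinate in the basis reduces the claim to such vectors
    and the product rule.\<close>
  have "((\<lambda>z. \<Sum>j\<in>UNIV. snd z $ j *\<^sub>R ?P (fst z) (axis j 1)) has_derivative
      (\<lambda>w. \<Sum>j\<in>UNIV. snd (?x, ?y) $ j *\<^sub>R transition_hess c d ?x (fst w) (axis j 1)
        + snd w $ j *\<^sub>R ?P (fst (?x, ?y)) (axis j 1))) (at (?x, ?y))"
    by (intro has_derivative_sum has_derivative_scaleR
        bounded_linear.has_derivative[OF bounded_linear_vec_nth sndy]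
        has_derivative_compose[OF fstx])
      (simp add: transition_hess_has_derivative[OF c d x])
  then have "((\<lambda>z. \<Sum>j\<in>UNIV. snd z $ j *\<^sub>R ?P (fst z) (axis j 1)) has_derivative
      (\<lambda>w. ?P ?x (snd w) + transition_hess c d ?x (fst w) ?y)) (at (?x, ?y))"
    by (rule has_derivative_eq_rhs)
      (simp only: expP[of "snd _"] expB sum.distrib fst_conv snd_conv add.commute)
  moreover have "((\<lambda>z. transition c d (fst z)) has_derivative (\<lambda>w. ?P ?x (fst w))) (at (?x, ?y))"
    using has_derivative_compose[OF fstx, of "transition c d" "?P ?x"]
      transition_deriv_has_derivative[OF c d x] by simp
  ultimately show "((\<lambda>z. (transition c d (fst z), \<Sum>j\<in>UNIV. snd z $ j *\<^sub>R ?P (fst z) (axis j 1)))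
      has_derivative (\<lambda>w. (?P ?x (fst w), ?P ?x (snd w) + transition_hess c d ?x (fst w) ?y)))
      (at (snd (slit_chart A c) u))"
    unfolding slit_chart_map by (intro has_derivative_Pair)
  show "open (?S \<times> (- {0::real^'n}))"
    by (intro open_Times chart_open_image[OF M c d] open_Compl closed_singleton)
  show "snd (slit_chart A c) u \<in> ?S \<times> (- {0})"
    unfolding slit_chart_map using x coord_y_nonzero[OF c u(1)] by simp
  fix z assume "z \<in> ?S \<times> (- {0::real^'n})"
  then obtain u' where u': "u' \<in> fst (slit_chart A c)" "u' \<in> fst (slit_chart A d)"
    "z = snd (slit_chart A c) u'"
    unfolding slit_chart_overlap[OF c d, symmetric] by blast
  show "(transition c d (fst z), \<Sum>j\<in>UNIV. snd z $ j *\<^sub>R ?P (fst z) (axis j 1)) =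
      transition (slit_chart A c) (slit_chart A d) z"
    unfolding u'(3) slit_transition_image[OF c u'(1)] unfolding slit_chart_map coord_transform[OF c d u'(1,2)]
    by (simp only: fst_conv snd_conv linear_axis_expansion[OF linP[OF coord_x_mem[OF u'(1,2)]], of "coord_y c u'"])
qed

text \<open>Takes the place of \<open>frechet_derivative_transition_comp\<close>, which presupposes
  a manifold topology. It is what makes the families built by \<open>tangent_of\<close> tangent
  vectors of the slit bundle.\<close>

lemma slit_transition_comp:
  assumes c: "c \<in> A" and d: "d \<in> A" and e: "e \<in> A"
    and u: "u \<in> fst (slit_chart A c)" "u \<in> fst (slit_chart A d)" "u \<in> fst (slit_chart A e)"
  shows "frechet_derivative (transition (slit_chart A c) (slit_chart A e)) (at (snd (slit_chart A c) u)) w =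
    frechet_derivative (transition (slit_chart A d) (slit_chart A e)) (at (snd (slit_chart A d) u))
      (frechet_derivative (transition (slit_chart A c) (slit_chart A d)) (at (snd (slit_chart A c) u)) w)"
proof -
  let ?c = "slit_chart A c" and ?d = "slit_chart A d" and ?e = "slit_chart A e"
  have works: "(transition (slit_chart A c) (slit_chart A d) has_derivative
      frechet_derivative (transition (slit_chart A c) (slit_chart A d)) (at (snd (slit_chart A c) u)))
      (at (snd (slit_chart A c) u))"
    if "c \<in> A" "d \<in> A" "u \<in> fst (slit_chart A c)" "u \<in> fst (slit_chart A d)" for c d
    by (rule frechet_derivative_works[THEN iffD1, OF differentiableI[OF slit_transition_has_derivative[OF that]]])
  have "frechet_derivative (transition ?c ?e) (at (snd ?c u)) =
      (\<lambda>w. frechet_derivative (transition ?d ?e) (at (snd ?d u))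
        (frechet_derivative (transition ?c ?d) (at (snd ?c u)) w))"
  proof (rule frechet_derivative_transition_chain[where
          P = "frechet_derivative (transition ?c ?d) (at (snd ?c u))" and
          Q = "frechet_derivative (transition ?d ?e) (at (snd ?d u))"])
    show "(transition ?c ?d has_derivative frechet_derivative (transition ?c ?d) (at (snd ?c u)))
        (at (snd ?c u))"
      by (rule works[OF c d u(1,2)])
    show "(transition ?d ?e has_derivative frechet_derivative (transition ?d ?e) (at (snd ?d u)))
        (at (transition ?c ?d (snd ?c u)))"
      unfolding slit_transition_image[OF c u(1)] by (rule works[OF d e u(2,3)])
    show "open (snd ?c ` (fst ?c \<inter> fst ?d))"
      unfolding slit_chart_overlap[OF c d] by (intro open_Times chart_open_image[OF M c d] open_Compl closed_singleton)
    show "snd ?c u \<in> snd ?c ` (fst ?c \<inter> fst ?d)"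
      using u by blast
    fix z assume "z \<in> snd ?c ` (fst ?c \<inter> fst ?d)"
    then obtain u' where u': "u' \<in> fst ?c" "u' \<in> fst ?d" "z = snd ?c u'" by blast
    show "chart_inv ?d (transition ?c ?d z) = chart_inv ?c z"
      unfolding u'(3) slit_transition_image[OF c u'(1)]
      by (simp only: chart_inv_slit_chart[OF c u'(1)] chart_inv_slit_chart[OF d u'(2)])
  qed
  then show ?thesis by (rule fun_cong)
qed

lemma slit_transition_self:
  assumes c: "c \<in> A" and u: "u \<in> fst (slit_chart A c)"
  shows "frechet_derivative (transition (slit_chart A c) (slit_chart A c)) (at (snd (slit_chart A c) u)) w = w"
proof -
  let ?c = "slit_chart A c"
  have "(transition ?c ?c has_derivative (\<lambda>w. w)) (at (snd ?c u))"
  proof (rule has_derivative_transform_within_open[OF has_derivative_ident])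
    show "open (snd ?c ` fst ?c)"
      unfolding slit_chart_image[OF c] by (intro open_Times smooth_manifold_chart(2)[OF M c] open_Compl closed_singleton)
    show "snd ?c u \<in> snd ?c ` fst ?c" using u by blast
    fix z assume "z \<in> snd ?c ` fst ?c"
    then obtain u' where u': "u' \<in> fst ?c" "z = snd ?c u'" by blast
    show "z = transition ?c ?c z"
      unfolding u'(2) slit_transition_image[OF c u'(1)] ..
  qed
  from frechet_derivative_eqI[OF this] show ?thesis by simp
qed

lemma slit_tangent_of_in_tangent_space:
  assumes c: "c \<in> A" and u: "u \<in> fst (slit_chart A c)"
  shows "tangent_of (slit_tangent_bundle A) (slit_chart A c) u w \<in> tangent_space (slit_tangent_bundle A) u"
proof -
  let ?S = "slit_tangent_bundle A" and ?c = "slit_chart A c"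
  let ?X = "tangent_of ?S ?c u w"
  have "?X e' = frechet_derivative (transition d' e') (at (snd d' u)) (?X d')"
    if mem: "d' \<in> ?S" "e' \<in> ?S" "u \<in> fst d'" "u \<in> fst e'" for d' e'
  proof -
    obtain d e where de: "d \<in> A" "d' = slit_chart A d" "e \<in> A" "e' = slit_chart A e"
      using mem(1,2) unfolding slit_tangent_bundle_def by blast
    have "?X e' = frechet_derivative (transition ?c e') (at (snd ?c u)) w"
      "?X d' = frechet_derivative (transition ?c d') (at (snd ?c u)) w"
      using mem by (simp_all add: tangent_of_def)
    then show ?thesis
      using slit_transition_comp[OF c de(1,3) u] mem(3,4) unfolding de by simp
  qed
  moreover have "?X d' = 0" if "d' \<notin> ?S \<or> u \<notin> fst d'" for d'
    using that unfolding tangent_of_def by auto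
  ultimately show ?thesis
    unfolding tangent_space_def mem_Collect_eq by blast
qed

lemma slit_tangent_of_self:
  assumes c: "c \<in> A" and u: "u \<in> fst (slit_chart A c)"
  shows "tangent_of (slit_tangent_bundle A) (slit_chart A c) u w (slit_chart A c) = w"
  using c u slit_transition_self[OF c u] by (simp add: tangent_of_def slit_tangent_bundle_def)

lemma slit_tangent_eqI:
  assumes c: "c \<in> A" and u: "u \<in> fst (slit_chart A c)"
    and X: "X \<in> tangent_space (slit_tangent_bundle A) u"
    and Y: "Y \<in> tangent_space (slit_tangent_bundle A) u"
    and eq: "X (slit_chart A c) = Y (slit_chart A c)"
  shows "X = Y"
proof -
  have S: "slit_chart A c \<in> slit_tangent_bundle A"
    using c by (simp add: slit_tangent_bundle_def)
  show ?thesis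
    by (rule trans[OF tangent_of_component[OF X S u, symmetric, unfolded eq] tangent_of_component[OF Y S u]])
qed

lemma slit_tangent_transform:
  assumes c: "c \<in> A" and d: "d \<in> A"
    and u: "u \<in> fst (slit_chart A c)" "u \<in> fst (slit_chart A d)"
    and X: "X \<in> tangent_space (slit_tangent_bundle A) u"
  shows "X (slit_chart A d) =
    (transition_deriv c d (coord_x c u) (fst (X (slit_chart A c))),
     transition_deriv c d (coord_x c u) (snd (X (slit_chart A c))) +
     transition_hess c d (coord_x c u) (fst (X (slit_chart A c))) (coord_y c u))"
proof -
  have "X (slit_chart A d) = frechet_derivative (transition (slit_chart A c) (slit_chart A d))
      (at (snd (slit_chart A c) u)) (X (slit_chart A c))"
    using c d by (intro tangent_spaceD(1)[OF X] u) (simp_all add: slit_tangent_bundle_def)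
  then show ?thesis
    by (simp only: frechet_derivative_eqI[OF slit_transition_has_derivative[OF c d u]])
qed

lemma slit_tangent_of_linear:
  assumes c: "c \<in> A" and u: "u \<in> fst (slit_chart A c)"
  shows "linear (tangent_of (slit_tangent_bundle A) (slit_chart A c) u)"
proof -
  have L: "linear (frechet_derivative (transition (slit_chart A c) d) (at (snd (slit_chart A c) u)))"
    if d: "d \<in> slit_tangent_bundle A" "u \<in> fst d" for d
  proof -
    obtain e where e: "e \<in> A" "d = slit_chart A e"
      using d(1) unfolding slit_tangent_bundle_def by blast
    note D = slit_transition_has_derivative[OF c e(1) u d(2)[unfolded e(2)]]
    show ?thesis
      unfolding e(2) frechet_derivative_eqI[OF D] by (rule has_derivative_linear[OF D])
  qed
  show ?thesis
    by (rule linearI)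
      (auto simp: tangent_of_def plus_fun_def scaleR_fun_def fun_eq_iff
        linear_add[OF L] linear_scale[OF L])
qed

section \<open>Chart independence of the metric and the endomorphism\<close>

lemma coord_x_in_chart:
  "u \<in> fst (slit_chart A c) \<Longrightarrow> coord_x c u \<in> snd c ` fst c"
  by (simp add: slit_chart_mem coord_x_def)

lemma norm_y_pos:
  assumes c: "c \<in> A" and u: "u \<in> fst (slit_chart A c)"
  shows "norm_y A g c u > 0"
  unfolding norm_y_eq
  using metric_form_pos[OF c coord_x_in_chart[OF u] coord_y_nonzero[OF c u]] by simp

text \<open>\<open>X_hor\<close> differs from the coordinate vector by a Christoffel term, hence the
  correction in the second component. From here on \<open>J_loc\<close> is handled through
  coordinate vectors instead of frame sums.\<close>

lemma J_loc_eq_tangent_of: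
  assumes c: "c \<in> A" and u: "u \<in> fst (slit_chart A c)"
  shows "J_loc A g c u X = tangent_of (slit_tangent_bundle A) (slit_chart A c) u
    ((1 / norm_y A g c u) *\<^sub>R delta_vec A g c u X,
     - (norm_y A g c u *\<^sub>R fst (X (slit_chart A c))) -
       christoffel_form A g c (coord_x c u) (coord_y c u)
         ((1 / norm_y A g c u) *\<^sub>R delta_vec A g c u X))"
proof -
  let ?t = "tangent_of (slit_tangent_bundle A) (slit_chart A c) u" and ?r = "norm_y A g c u"
  let ?G = "christoffel_form A g c (coord_x c u) (coord_y c u)"
  let ?xi = "fst (X (slit_chart A c))" and ?z = "delta_vec A g c u X"
  note t = slit_tangent_of_linear[OF c u]
  \<comment> \<open>The two halves of \<open>?t\<close> are linear by themselves, so each frame sum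
    collapses to one value of a linear map.\<close>
  define t1 where "t1 a = ?t (a, 0)" for a
  define t2 where "t2 b = ?t (0, b)" for b
  have t1: "linear t1" and t2: "linear t2"
    using linear_compose[OF linear_Pair_zero(1) t] linear_compose[OF linear_Pair_zero(2) t]
    by (simp_all add: o_def t1_def[abs_def] t2_def[abs_def])
  have split: "?t (a, b) = t1 a + t2 b" for a b
    using linear_add[OF t, of "(a, 0)" "(0, b)"] by (simp add: t1_def t2_def)
  have ver: "X_ver A c u i = t2 (axis i 1)" for i
    by (simp add: X_ver_def d_dy_def t2_def)
  have hor: "X_hor A g c u i = t1 (axis i 1) - t2 (?G (axis i 1))" for i
    unfolding linear_axis_expansion[OF t2, of "?G _"]
    by (simp add: X_hor_def d_dx_def d_dy_def t1_def t2_def Gamma_at_def christoffel_form_axis_right)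
  have f: "linear (\<lambda>a. - ?r *\<^sub>R t2 a)"
    by (rule linear_compose_scale_right[OF t2])
  have h: "linear (\<lambda>a. (1 / ?r) *\<^sub>R (t1 a - t2 (?G a)))"
    by (intro linear_compose_scale_right linear_compose_sub t1
        linear_compose[OF linear_christoffel_form(2) t2, unfolded o_def])
  have "J_loc A g c u X = (\<Sum>i\<in>UNIV. ?xi $ i *\<^sub>R (- ?r *\<^sub>R t2 (axis i 1))) +
      (\<Sum>i\<in>UNIV. ?z $ i *\<^sub>R ((1 / ?r) *\<^sub>R (t1 (axis i 1) - t2 (?G (axis i 1)))))"
    by (simp only: J_loc_def dx_def delta_y_eq ver hor)
  also have "\<dots> = - ?r *\<^sub>R t2 ?xi + (1 / ?r) *\<^sub>R (t1 ?z - t2 (?G ?z))"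
    by (simp only: linear_axis_expansion[OF f, of ?xi] linear_axis_expansion[OF h, of ?z])
  also have "\<dots> = t1 ((1 / ?r) *\<^sub>R ?z) + t2 (- (?r *\<^sub>R ?xi) - ?G ((1 / ?r) *\<^sub>R ?z))"
    unfolding linear_scale[OF t1] linear_diff[OF t2] linear_neg[OF t2] linear_scale[OF t2]
      linear_scale[OF linear_christoffel_form(2)] scaleR_diff_right by simp
  finally show ?thesis by (simp only: split)
qed

lemma J_loc_in_tangent_space:
  assumes "c \<in> A" "u \<in> fst (slit_chart A c)"
  shows "J_loc A g c u X \<in> tangent_space (slit_tangent_bundle A) u"
  unfolding J_loc_eq_tangent_of[OF assms] by (rule slit_tangent_of_in_tangent_space[OF assms])

text \<open>Passing to \<open>delta_vec\<close> adds the same Christoffel term that the coordinate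
  expression subtracts.\<close>

lemma J_loc_components:
  assumes "c \<in> A" "u \<in> fst (slit_chart A c)"
  shows "fst (J_loc A g c u X (slit_chart A c)) = (1 / norm_y A g c u) *\<^sub>R delta_vec A g c u X"
    and "delta_vec A g c u (J_loc A g c u X) = - (norm_y A g c u *\<^sub>R fst (X (slit_chart A c)))"
  unfolding delta_vec_def[of A g c u "J_loc A g c u X"]
  unfolding J_loc_eq_tangent_of[OF assms] slit_tangent_of_self[OF assms] by simp_all

text \<open>\<open>delta_vec\<close> shifts the vertical coordinates by a term that depends on the
  base part only, so the two parts together determine the coordinate vector.\<close>

lemma slit_tangent_components_eqI:
  assumes c: "c \<in> A" and u: "u \<in> fst (slit_chart A c)"
    and X: "X \<in> tangent_space (slit_tangent_bundle A) u"
    and Y: "Y \<in> tangent_space (slit_tangent_bundle A) u"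
    and eq: "fst (X (slit_chart A c)) = fst (Y (slit_chart A c))"
      "delta_vec A g c u X = delta_vec A g c u Y"
  shows "X = Y"
proof (rule slit_tangent_eqI[OF c u X Y])
  show "X (slit_chart A c) = Y (slit_chart A c)"
    using eq(2) unfolding delta_vec_def eq(1) by (simp add: prod_eq_iff eq(1))
qed

text \<open>For \<open>delta_vec\<close>, the derivative of the slit transition brings the Hessian
  at \<open>(\<xi>, y)\<close> and the law of the Christoffel symbols brings it at
  \<open>(y, \<xi>)\<close>; by symmetry the two agree.\<close>

lemma components_transform:
  assumes c: "c \<in> A" and d: "d \<in> A"
    and u: "u \<in> fst (slit_chart A c)" "u \<in> fst (slit_chart A d)"
    and X: "X \<in> tangent_space (slit_tangent_bundle A) u"
  shows "fst (X (slit_chart A d)) = transition_deriv c d (coord_x c u) (fst (X (slit_chart A c)))"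
    and "delta_vec A g d u X = transition_deriv c d (coord_x c u) (delta_vec A g c u X)"
proof -
  note x = coord_x_mem[OF u]
  note Xd = slit_tangent_transform[OF c d u X]
  show "fst (X (slit_chart A d)) = transition_deriv c d (coord_x c u) (fst (X (slit_chart A c)))"
    unfolding Xd by simp
  have lin: "linear (transition_deriv c d (coord_x c u))"
    by (rule has_derivative_linear[OF transition_deriv_has_derivative[OF c d x]])
  show "delta_vec A g d u X = transition_deriv c d (coord_x c u) (delta_vec A g c u X)"
    unfolding delta_vec_def Xd coord_transform[OF c d u] linear_add[OF lin]
      christoffel_form_transform[OF c d x]
      transition_hess_sym[OF c d x, of "coord_y c u"] by simp
qed

lemma norm_y_transform:
  assumes c: "c \<in> A" and d: "d \<in> A"
    and u: "u \<in> fst (slit_chart A c)" "u \<in> fst (slit_chart A d)"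
  shows "norm_y A g d u = norm_y A g c u"
  unfolding norm_y_eq coord_transform[OF c d u]
  by (simp only: metric_form_transform[OF c d coord_x_mem[OF u]])

lemma h_loc_transform:
  assumes c: "c \<in> A" and d: "d \<in> A"
    and u: "u \<in> fst (slit_chart A c)" "u \<in> fst (slit_chart A d)"
    and X: "X \<in> tangent_space (slit_tangent_bundle A) u"
    and Y: "Y \<in> tangent_space (slit_tangent_bundle A) u"
  shows "h_loc A g d u X Y = h_loc A g c u X Y"
  unfolding h_loc_eq components_transform[OF c d u X] components_transform[OF c d u Y]
    norm_y_transform[OF c d u] coord_transform(1)[OF c d u]
    metric_form_transform[OF c d coord_x_mem[OF u]] ..

lemma J_loc_transform:
  assumes c: "c \<in> A" and d: "d \<in> A"
    and u: "u \<in> fst (slit_chart A c)" "u \<in> fst (slit_chart A d)"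
    and X: "X \<in> tangent_space (slit_tangent_bundle A) u"
  shows "J_loc A g d u X = J_loc A g c u X"
proof (rule slit_tangent_components_eqI[OF d u(2)])
  note Jc = J_loc_in_tangent_space[OF c u(1), of X]
  show "J_loc A g c u X \<in> tangent_space (slit_tangent_bundle A) u" by (rule Jc)
  show "J_loc A g d u X \<in> tangent_space (slit_tangent_bundle A) u"
    by (rule J_loc_in_tangent_space[OF d u(2)])
  have lin: "linear (transition_deriv c d (coord_x c u))"
    by (rule has_derivative_linear[OF transition_deriv_has_derivative[OF c d coord_x_mem[OF u]]])
  show "fst (J_loc A g d u X (slit_chart A d)) = fst (J_loc A g c u X (slit_chart A d))"
    unfolding components_transform(1)[OF c d u Jc] J_loc_components[OF c u(1)]
      J_loc_components[OF d u(2)] components_transform[OF c d u X] norm_y_transform[OF c d u]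
      linear_scale[OF lin] ..
  show "delta_vec A g d u (J_loc A g d u X) = delta_vec A g d u (J_loc A g c u X)"
    unfolding components_transform(2)[OF c d u Jc] J_loc_components[OF c u(1)]
      J_loc_components[OF d u(2)] components_transform[OF c d u X] norm_y_transform[OF c d u]
      linear_neg[OF lin] linear_scale[OF lin] ..
qed

text \<open>Existence is chart independence, which concerns genuine tangent vectors \<open>X\<close>
  and \<open>Y\<close>. Uniqueness holds because \<open>c\<close> is a chart around
  \<open>u\<close>, so the quantifier is not vacuous.\<close>

lemma h_Q_eq:
  assumes c: "c \<in> A" and u: "u \<in> fst (slit_chart A c)"
    and X: "X \<in> tangent_space (slit_tangent_bundle A) u"
    and Y: "Y \<in> tangent_space (slit_tangent_bundle A) u"
  shows "h_Q A g u X Y = h_loc A g c u X Y"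
  unfolding h_Q_def
proof (rule the_equality)
  show "\<forall>d\<in>A. u \<in> fst (slit_chart A d) \<longrightarrow> h_loc A g c u X Y = h_loc A g d u X Y"
    by (intro ballI impI h_loc_transform[OF c _ u _ X Y, symmetric])
qed (use c u in blast)

lemma J_Q_eq:
  assumes c: "c \<in> A" and u: "u \<in> fst (slit_chart A c)"
    and X: "X \<in> tangent_space (slit_tangent_bundle A) u"
  shows "J_Q A g u X = J_loc A g c u X"
  unfolding J_Q_def
proof (rule the_equality)
  show "\<forall>d\<in>A. u \<in> fst (slit_chart A d) \<longrightarrow> J_loc A g c u X = J_loc A g d u X"
    by (intro ballI impI J_loc_transform[OF c _ u _ X, symmetric])
qed (use c u in blast)

section \<open>The almost Hermitian structure\<close>

lemma smooth_on_metric_comp: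
  "c \<in> A \<Longrightarrow> smooth_on (snd c ` fst c) (\<lambda>x. metric_comp A g c x $ i $ j)"
  unfolding metric_form_axis[symmetric] by (rule smooth_on_metric_form)

lemma smooth_on_christoffel:
  assumes c: "c \<in> A"
  shows "smooth_on (snd c ` fst c) (\<lambda>x. christoffel A g c x i j k)"
  unfolding christoffel_def partial_def
  by (intro smooth_on_divide smooth_on_sum smooth_on_mult smooth_on_diff smooth_on_add
      smooth_on_derivative smooth_on_metric_comp smooth_on_matrix_inv smooth_on_const
      smooth_manifold_chart(2)[OF M] metric_comp_invertible[OF M g] c) simp_all

context
  fixes c
  assumes c: "c \<in> A"
begin

lemma open_slit_image: "open ((snd c ` fst c) \<times> (- {0::real^'n}))"
  by (intro open_Times smooth_manifold_chart(2)[OF M c] open_Compl closed_singleton)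

lemma smooth_on_slit_fst:
  assumes "smooth_on (snd c ` fst c) f"
  shows "smooth_on ((snd c ` fst c) \<times> (- {0::real^'n})) (\<lambda>z. f (fst z))"
  by (rule smooth_on_fst[OF smooth_manifold_chart(2)[OF M c] _ assms])
    (intro open_Compl closed_singleton)

lemma smooth_on_slit_metric_form:
  assumes "smooth_on ((snd c ` fst c) \<times> (- {0})) v" "smooth_on ((snd c ` fst c) \<times> (- {0})) w"
  shows "smooth_on ((snd c ` fst c) \<times> (- {0::real^'n})) (\<lambda>z. metric_form A g c (fst z) (v z) (w z))"
  unfolding metric_form_eq_sum
  by (intro smooth_on_sum smooth_on_mult smooth_on_vec_nth open_slit_image assms
      smooth_on_slit_fst[OF smooth_on_metric_comp[OF c]])

lemma smooth_on_slit_christoffel_form: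
  assumes "smooth_on ((snd c ` fst c) \<times> (- {0})) v" "smooth_on ((snd c ` fst c) \<times> (- {0})) w"
  shows "smooth_on ((snd c ` fst c) \<times> (- {0::real^'n})) (\<lambda>z. christoffel_form A g c (fst z) (v z) (w z))"
  unfolding christoffel_form_def
  by (rule smooth_on_vec[OF open_slit_image], unfold vec_lambda_beta)
    (intro smooth_on_sum smooth_on_mult smooth_on_vec_nth open_slit_image assms
      smooth_on_slit_fst[OF smooth_on_christoffel[OF c]])

lemma smooth_on_snd: "smooth_on S (snd :: (real^'n) \<times> (real^'n) \<Rightarrow> real^'n)"
  by (rule smooth_on_bounded_linear[OF bounded_linear_snd])

text \<open>Off the zero section this makes the root in the norm smooth and division by the norm
  legitimate.\<close>

lemma slit_norm_pos:
  "z \<in> (snd c ` fst c) \<times> (- {0}) \<Longrightarrow> metric_form A g c (fst z) (snd z) (snd z) > 0"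
  by (intro metric_form_pos[OF c]) (auto simp: mem_Times_iff)

lemma smooth_on_slit_norm:
  "smooth_on ((snd c ` fst c) \<times> (- {0::real^'n})) (\<lambda>z. sqrt (metric_form A g c (fst z) (snd z) (snd z)))"
  by (intro smooth_on_sqrt open_slit_image slit_norm_pos smooth_on_slit_metric_form smooth_on_snd)

lemma smooth_on_h_Q:
  "smooth_on (snd (slit_chart A c) ` fst (slit_chart A c))
    (\<lambda>z. h_Q A g (chart_inv (slit_chart A c) z)
      (tangent_of (slit_tangent_bundle A) (slit_chart A c) (chart_inv (slit_chart A c) z) v)
      (tangent_of (slit_tangent_bundle A) (slit_chart A c) (chart_inv (slit_chart A c) z) w))"
  unfolding slit_chart_image[OF c]
proof (rule smooth_on_cong[OF open_slit_image])
  let ?d = "\<lambda>z v. snd v + christoffel_form A g c (fst z) (snd z) (fst v)"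
  let ?r = "\<lambda>z. sqrt (metric_form A g c (fst z) (snd z) (snd z))"
  \<comment> \<open>The squared norm is written as a product, the form that the smoothness rules
    accept; \<open>power2_eq_square\<close> reconciles it with \<open>h_loc\<close> at the
    end.\<close>
  let ?h = "\<lambda>z. 2 * metric_form A g c (fst z) (fst v) (fst w) +
      2 / (?r z * ?r z) * metric_form A g c (fst z) (?d z v) (?d z w)"
  show "smooth_on ((snd c ` fst c) \<times> (- {0})) ?h"
    by (intro smooth_on_add smooth_on_mult smooth_on_divide smooth_on_slit_norm
        smooth_on_slit_metric_form smooth_on_slit_christoffel_form smooth_on_const smooth_on_snd
        open_slit_image) (use slit_norm_pos in fastforce)
  fix z assume "z \<in> (snd c ` fst c) \<times> (- {0::real^'n})"
  then obtain u where u: "u \<in> fst (slit_chart A c)" "z = snd (slit_chart A c) u"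
    unfolding slit_chart_image[OF c, symmetric] by blast
  have z: "fst z = coord_x c u" "snd z = coord_y c u"
    unfolding u(2) slit_chart_map by simp_all
  show "?h z = h_Q A g (chart_inv (slit_chart A c) z)
      (tangent_of (slit_tangent_bundle A) (slit_chart A c) (chart_inv (slit_chart A c) z) v)
      (tangent_of (slit_tangent_bundle A) (slit_chart A c) (chart_inv (slit_chart A c) z) w)"
    unfolding z unfolding u(2) chart_inv_slit_chart[OF c u(1)]
      h_Q_eq[OF c u(1) slit_tangent_of_in_tangent_space[OF c u(1)]
        slit_tangent_of_in_tangent_space[OF c u(1)]]
      h_loc_eq norm_y_eq delta_vec_def slit_tangent_of_self[OF c u(1)]
    by (simp only: power2_eq_square)
qed

lemma smooth_on_J_Q:
  "smooth_on (snd (slit_chart A c) ` fst (slit_chart A c))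
    (\<lambda>z. J_Q A g (chart_inv (slit_chart A c) z)
      (tangent_of (slit_tangent_bundle A) (slit_chart A c) (chart_inv (slit_chart A c) z) w)
      (slit_chart A c))"
  unfolding slit_chart_image[OF c]
proof (rule smooth_on_cong[OF open_slit_image])
  let ?d = "\<lambda>z. snd w + christoffel_form A g c (fst z) (snd z) (fst w)"
  let ?r = "\<lambda>z. sqrt (metric_form A g c (fst z) (snd z) (snd z))"
  let ?J = "\<lambda>z. ((1 / ?r z) *\<^sub>R ?d z, - (?r z *\<^sub>R fst w) -
      christoffel_form A g c (fst z) (snd z) ((1 / ?r z) *\<^sub>R ?d z))"
  show "smooth_on ((snd c ` fst c) \<times> (- {0})) ?J"
    by (intro smooth_on_Pair smooth_on_scaleR smooth_on_diff smooth_on_minus smooth_on_add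
        smooth_on_divide smooth_on_slit_norm
        smooth_on_slit_christoffel_form smooth_on_const smooth_on_snd
        open_slit_image) (use slit_norm_pos in fastforce)+
  fix z assume "z \<in> (snd c ` fst c) \<times> (- {0::real^'n})"
  then obtain u where u: "u \<in> fst (slit_chart A c)" "z = snd (slit_chart A c) u"
    unfolding slit_chart_image[OF c, symmetric] by blast
  have z: "fst z = coord_x c u" "snd z = coord_y c u"
    unfolding u(2) slit_chart_map by simp_all
  show "?J z = J_Q A g (chart_inv (slit_chart A c) z)
      (tangent_of (slit_tangent_bundle A) (slit_chart A c) (chart_inv (slit_chart A c) z) w)
      (slit_chart A c)"
    unfolding z unfolding u(2) chart_inv_slit_chart[OF c u(1)]
      J_Q_eq[OF c u(1) slit_tangent_of_in_tangent_space[OF c u(1)]]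
      J_loc_eq_tangent_of[OF c u(1)] norm_y_eq delta_vec_def slit_tangent_of_self[OF c u(1)] ..
qed

section \<open>Algebraic identities at a fixed point\<close>

context
  fixes u
  assumes u: "u \<in> fst (slit_chart A c)"
begin

text \<open>The combination of two families equals \<open>tangent_of\<close> applied to the same
  combination of their coordinate vectors, and such values are tangent vectors.\<close>

lemma slit_tangent_space_combination:
  assumes "X \<in> tangent_space (slit_tangent_bundle A) u" "Y \<in> tangent_space (slit_tangent_bundle A) u"
  shows "a *\<^sub>R X + b *\<^sub>R Y \<in> tangent_space (slit_tangent_bundle A) u"
proof -
  let ?t = "tangent_of (slit_tangent_bundle A) (slit_chart A c) u"
  have S: "slit_chart A c \<in> slit_tangent_bundle A"
    using c by (simp add: slit_tangent_bundle_def)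
  have "?t (a *\<^sub>R X (slit_chart A c) + b *\<^sub>R Y (slit_chart A c)) = a *\<^sub>R X + b *\<^sub>R Y"
    unfolding linear_add[OF slit_tangent_of_linear[OF c u]]
      linear_scale[OF slit_tangent_of_linear[OF c u]]
      tangent_of_component[OF assms(1) S u] tangent_of_component[OF assms(2) S u] ..
  then show ?thesis
    using slit_tangent_of_in_tangent_space[OF c u] by metis
qed

lemma fst_combination:
  "fst ((a *\<^sub>R X + b *\<^sub>R Y) (slit_chart A c)) =
    a *\<^sub>R fst (X (slit_chart A c)) + b *\<^sub>R fst (Y (slit_chart A c))"
  by (simp add: scaleR_fun_def)

lemma delta_vec_combination:
  "delta_vec A g c u (a *\<^sub>R X + b *\<^sub>R Y) = a *\<^sub>R delta_vec A g c u X + b *\<^sub>R delta_vec A g c u Y"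
  unfolding delta_vec_def fst_combination linear_add[OF linear_christoffel_form(2)]
    linear_scale[OF linear_christoffel_form(2)]
  by (simp add: scaleR_fun_def scaleR_add_right)

lemma h_Q_sym:
  assumes "X \<in> tangent_space (slit_tangent_bundle A) u" "Y \<in> tangent_space (slit_tangent_bundle A) u"
  shows "h_Q A g u X Y = h_Q A g u Y X"
  unfolding h_Q_eq[OF c u assms] h_Q_eq[OF c u assms(2,1)] h_loc_eq
  by (simp only: metric_form_sym[OF c coord_x_in_chart[OF u], of "fst (X _)"]
      metric_form_sym[OF c coord_x_in_chart[OF u], of "delta_vec A g c u X"])

lemma h_Q_linear:
  assumes X: "X \<in> tangent_space (slit_tangent_bundle A) u"
    and Y: "Y \<in> tangent_space (slit_tangent_bundle A) u"
    and Z: "Z \<in> tangent_space (slit_tangent_bundle A) u"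
  shows "h_Q A g u (a *\<^sub>R X + b *\<^sub>R Y) Z = a * h_Q A g u X Z + b * h_Q A g u Y Z"
  unfolding h_Q_eq[OF c u X Z] h_Q_eq[OF c u Y Z]
    h_Q_eq[OF c u slit_tangent_space_combination[OF X Y] Z] h_loc_eq
    fst_combination delta_vec_combination
    linear_add[OF linear_metric_form(1)] linear_scale[OF linear_metric_form(1)]
  by (simp add: algebra_simps)

lemma h_Q_pos:
  assumes X: "X \<in> tangent_space (slit_tangent_bundle A) u" and nz: "X \<noteq> 0"
  shows "h_Q A g u X X > 0"
proof -
  let ?m = "metric_form A g c (coord_x c u)"
  let ?xi = "fst (X (slit_chart A c))" and ?z = "delta_vec A g c u X"
  note pos = metric_form_pos[OF c coord_x_in_chart[OF u]]
  have m0: "?m 0 0 = 0"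
    by (rule linear_0[OF linear_metric_form(2)])
  have nonneg: "?m v v \<ge> 0" for v
    using pos[of v] m0 by (cases "v = 0") (simp_all add: less_imp_le)
  have r: "2 / (norm_y A g c u)\<^sup>2 > 0"
    using norm_y_pos[OF c u] by simp
  have "?xi \<noteq> 0 \<or> ?z \<noteq> 0"
  proof (rule ccontr)
    assume "\<not> (?xi \<noteq> 0 \<or> ?z \<noteq> 0)"
    then have 0: "?xi = 0" "?z = 0" by simp_all
    \<comment> \<open>Zero is written as a combination so that its membership in the tangent space
      comes from the combination lemma.\<close>
    have "0 = 0 *\<^sub>R X + 0 *\<^sub>R X" by simp
    then have zero: "0 \<in> tangent_space (slit_tangent_bundle A) u"
      using slit_tangent_space_combination[OF X X, of 0 0] by simp
    have "X = 0"
    proof (rule slit_tangent_components_eqI[OF c u X zero])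
      show "?z = delta_vec A g c u 0"
        using 0(2) delta_vec_combination[of 0 X 0 X] by simp
    qed (use 0 in simp)
    with nz show False by simp
  qed
  then have "?m ?xi ?xi + 2 / (norm_y A g c u)\<^sup>2 * ?m ?z ?z > 0"
  proof
    assume "?xi \<noteq> 0"
    then show ?thesis
      using mult_nonneg_nonneg[OF less_imp_le[OF r] nonneg[of ?z]] pos[of ?xi] by linarith
  next
    assume "?z \<noteq> 0"
    then show ?thesis
      using mult_pos_pos[OF r pos[of ?z]] nonneg[of ?xi] by linarith
  qed
  then show ?thesis
    unfolding h_Q_eq[OF c u X X] h_loc_eq using nonneg[of ?xi] by linarith
qed

lemma J_Q_in_tangent_space:
  "X \<in> tangent_space (slit_tangent_bundle A) u \<Longrightarrow> J_Q A g u X \<in> tangent_space (slit_tangent_bundle A) u"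
  using J_loc_in_tangent_space[OF c u] J_Q_eq[OF c u] by simp

lemma J_Q_components:
  assumes "X \<in> tangent_space (slit_tangent_bundle A) u"
  shows "fst (J_Q A g u X (slit_chart A c)) = (1 / norm_y A g c u) *\<^sub>R delta_vec A g c u X"
    and "delta_vec A g c u (J_Q A g u X) = - (norm_y A g c u *\<^sub>R fst (X (slit_chart A c)))"
  unfolding J_Q_eq[OF c u assms] by (rule J_loc_components[OF c u])+

lemma J_Q_linear:
  assumes X: "X \<in> tangent_space (slit_tangent_bundle A) u"
    and Y: "Y \<in> tangent_space (slit_tangent_bundle A) u"
  shows "J_Q A g u (a *\<^sub>R X + b *\<^sub>R Y) = a *\<^sub>R J_Q A g u X + b *\<^sub>R J_Q A g u Y"
proof (rule slit_tangent_components_eqI[OF c u])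
  note XY = slit_tangent_space_combination[OF X Y]
  show "J_Q A g u (a *\<^sub>R X + b *\<^sub>R Y) \<in> tangent_space (slit_tangent_bundle A) u"
    by (rule J_Q_in_tangent_space[OF XY])
  show "a *\<^sub>R J_Q A g u X + b *\<^sub>R J_Q A g u Y \<in> tangent_space (slit_tangent_bundle A) u"
    by (rule slit_tangent_space_combination[OF J_Q_in_tangent_space[OF X] J_Q_in_tangent_space[OF Y]])
  show "fst (J_Q A g u (a *\<^sub>R X + b *\<^sub>R Y) (slit_chart A c)) =
      fst ((a *\<^sub>R J_Q A g u X + b *\<^sub>R J_Q A g u Y) (slit_chart A c))"
    unfolding fst_combination J_Q_components[OF XY] J_Q_components[OF X] J_Q_components[OF Y]
      delta_vec_combination by (simp add: scaleR_add_right mult.commute)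
  show "delta_vec A g c u (J_Q A g u (a *\<^sub>R X + b *\<^sub>R Y)) =
      delta_vec A g c u (a *\<^sub>R J_Q A g u X + b *\<^sub>R J_Q A g u Y)"
    unfolding delta_vec_combination J_Q_components[OF XY] J_Q_components[OF X] J_Q_components[OF Y]
      fst_combination by (simp add: scaleR_add_right mult.commute)
qed

lemma J_Q_squared:
  assumes X: "X \<in> tangent_space (slit_tangent_bundle A) u"
  shows "J_Q A g u (J_Q A g u X) = - X"
proof -
  note JX = J_Q_in_tangent_space[OF X]
  have r: "norm_y A g c u \<noteq> 0"
    using norm_y_pos[OF c u] by simp
  \<comment> \<open>In this shape \<open>- X\<close> is covered by the combination lemmas for
    membership, base part and vertical part.\<close>
  have "J_Q A g u (J_Q A g u X) = (- 1) *\<^sub>R X + 0 *\<^sub>R X"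
  proof (rule slit_tangent_components_eqI[OF c u J_Q_in_tangent_space[OF JX]
        slit_tangent_space_combination[OF X X]])
    show "fst (J_Q A g u (J_Q A g u X) (slit_chart A c)) = fst (((- 1) *\<^sub>R X + 0 *\<^sub>R X) (slit_chart A c))"
      unfolding J_Q_components[OF JX] J_Q_components[OF X] fst_combination using r by simp
    show "delta_vec A g c u (J_Q A g u (J_Q A g u X)) = delta_vec A g c u ((- 1) *\<^sub>R X + 0 *\<^sub>R X)"
      unfolding J_Q_components[OF JX] J_Q_components[OF X] delta_vec_combination using r by simp
  qed
  then show ?thesis by simp
qed

text \<open>The endomorphism exchanges the two summands of the metric: its factors
  \<open>1 / r\<close> and \<open>- r\<close> enter squared and turn the weight \<open>2\<close>
  into \<open>2 / r^2\<close> and back.\<close>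

lemma h_Q_J_Q:
  assumes X: "X \<in> tangent_space (slit_tangent_bundle A) u"
    and Y: "Y \<in> tangent_space (slit_tangent_bundle A) u"
  shows "h_Q A g u (J_Q A g u X) (J_Q A g u Y) = h_Q A g u X Y"
proof -
  have r: "norm_y A g c u \<noteq> 0"
    using norm_y_pos[OF c u] by simp
  show ?thesis
    unfolding h_Q_eq[OF c u J_Q_in_tangent_space[OF X] J_Q_in_tangent_space[OF Y]]
      h_Q_eq[OF c u X Y] h_loc_eq J_Q_components[OF X] J_Q_components[OF Y]
      linear_neg[OF linear_metric_form(1)] linear_scale[OF linear_metric_form(1)]
      linear_neg[OF linear_metric_form(2)] linear_scale[OF linear_metric_form(2)]
    using r by (simp add: field_simps power2_eq_square)
qed

text \<open>With \<open>r\<close> the norm, the form is \<open>2 / r\<close> times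
  \<open>g(\<delta>, \<xi>') - g(\<xi>, \<delta>')\<close>. The factor becomes 4 because the wedge
  halves the antisymmetrization; symmetry of \<open>g\<close> matches the second term.\<close>

lemma fundamental_form_eq:
  assumes X: "X \<in> tangent_space (slit_tangent_bundle A) u"
    and Y: "Y \<in> tangent_space (slit_tangent_bundle A) u"
  shows "fundamental_form (h_Q A g) (J_Q A g) u X Y =
    4 / norm_y A g c u * (\<Sum>i\<in>UNIV. \<Sum>j\<in>UNIV. g_at A g c u i j *
      (delta_y A g c u i \<and>\<^sub>w dx A c j) X Y)"
proof -
  let ?m = "metric_form A g c (coord_x c u)" and ?r = "norm_y A g c u"
  let ?X = "fst (X (slit_chart A c))" and ?Y = "fst (Y (slit_chart A c))"
  let ?dX = "delta_vec A g c u X" and ?dY = "delta_vec A g c u Y"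
  have r: "?r \<noteq> 0"
    using norm_y_pos[OF c u] by simp
  have "(\<Sum>i\<in>UNIV. \<Sum>j\<in>UNIV. g_at A g c u i j * (delta_y A g c u i \<and>\<^sub>w dx A c j) X Y) =
      (?m ?dX ?Y - ?m ?dY ?X) / 2"
    unfolding metric_form_eq_sum wedge_def delta_y_eq dx_def g_at_def
      sum_subtractf[symmetric] sum_divide_distrib
    by (intro sum.cong refl) (simp add: algebra_simps)
  moreover have "fundamental_form (h_Q A g) (J_Q A g) u X Y = 2 / ?r * (?m ?dX ?Y - ?m ?X ?dY)"
    unfolding fundamental_form_def h_Q_eq[OF c u J_Q_in_tangent_space[OF X] Y] h_loc_eq
      J_Q_components[OF X] linear_neg[OF linear_metric_form(1)] linear_scale[OF linear_metric_form(1)]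
    using r by (simp add: field_simps power2_eq_square)
  ultimately show ?thesis
    by (simp add: metric_form_sym[OF c coord_x_in_chart[OF u], of ?X])
qed

end

end

end

section \<open>From the single charts to the whole slit tangent bundle\<close>

theorem theorem21:
  fixes T :: "'a topology"
    and A :: "('a, real^'n) chart set"
    and g :: "'a \<Rightarrow> ('a, real^'n) tvec \<Rightarrow> ('a, real^'n) tvec \<Rightarrow> real"
  assumes "smooth_manifold T A"
    and "riemannian_metric A g"
  shows "almost_hermitian (slit_tangent_bundle A) (h_Q A g) (J_Q A g) \<and>
    (\<forall>c\<in>A. \<forall>u\<in>fst (slit_chart A c).
       \<forall>X\<in>tangent_space (slit_tangent_bundle A) u. \<forall>Y\<in>tangent_space (slit_tangent_bundle A) u.
         fundamental_form (h_Q A g) (J_Q A g) u X Y =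
           4 / norm_y A g c u *
             (\<Sum>i\<in>UNIV. \<Sum>j\<in>UNIV. g_at A g c u i j *
                (delta_y A g c u i \<and>\<^sub>w dx A c j) X Y))"
proof (intro conjI ballI)
  note M = assms(1) and g = assms(2)
  have cover: "\<exists>c\<in>A. u \<in> fst (slit_chart A c)" if "u \<in> \<Union>(fst ` slit_tangent_bundle A)" for u
    using that unfolding slit_tangent_bundle_def by blast
  have metric: "riemannian_metric (slit_tangent_bundle A) (h_Q A g)"
    unfolding riemannian_metric_def
  proof (intro conjI ballI allI impI)
    fix u X Y
    assume "u \<in> \<Union>(fst ` slit_tangent_bundle A)"
      and XY: "X \<in> tangent_space (slit_tangent_bundle A) u" "Y \<in> tangent_space (slit_tangent_bundle A) u"
    then obtain c where c: "c \<in> A" "u \<in> fst (slit_chart A c)" using cover by blast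
    show "h_Q A g u X Y = h_Q A g u Y X" by (rule h_Q_sym[OF M g c XY])
  next
    fix u X Y Z a b
    assume "u \<in> \<Union>(fst ` slit_tangent_bundle A)"
      and XYZ: "X \<in> tangent_space (slit_tangent_bundle A) u" "Y \<in> tangent_space (slit_tangent_bundle A) u"
        "Z \<in> tangent_space (slit_tangent_bundle A) u"
    then obtain c where c: "c \<in> A" "u \<in> fst (slit_chart A c)" using cover by blast
    show "h_Q A g u (a *\<^sub>R X + b *\<^sub>R Y) Z = a * h_Q A g u X Z + b * h_Q A g u Y Z"
      by (rule h_Q_linear[OF M g c XYZ])
  next
    fix u X
    assume "u \<in> \<Union>(fst ` slit_tangent_bundle A)"
      and X: "X \<in> tangent_space (slit_tangent_bundle A) u" "X \<noteq> 0"
    then obtain c where c: "c \<in> A" "u \<in> fst (slit_chart A c)" using cover by blast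
    show "h_Q A g u X X > 0" by (rule h_Q_pos[OF M g c X])
  next
    fix c' v w
    assume "c' \<in> slit_tangent_bundle A"
    then obtain c where c: "c \<in> A" "c' = slit_chart A c"
      unfolding slit_tangent_bundle_def by blast
    show "smooth_on (snd c' ` fst c')
       (\<lambda>x. h_Q A g (chart_inv c' x) (tangent_of (slit_tangent_bundle A) c' (chart_inv c' x) v)
                             (tangent_of (slit_tangent_bundle A) c' (chart_inv c' x) w))"
      unfolding c(2) by (rule smooth_on_h_Q[OF M g c(1)])
  qed
  have endo: "endomorphism_field (slit_tangent_bundle A) (J_Q A g)"
    unfolding endomorphism_field_def
  proof (intro conjI ballI allI)
    fix u X
    assume "u \<in> \<Union>(fst ` slit_tangent_bundle A)" and X: "X \<in> tangent_space (slit_tangent_bundle A) u"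
    then obtain c where c: "c \<in> A" "u \<in> fst (slit_chart A c)" using cover by blast
    show "J_Q A g u X \<in> tangent_space (slit_tangent_bundle A) u"
      by (rule J_Q_in_tangent_space[OF M g c X])
  next
    fix u X Y a b
    assume "u \<in> \<Union>(fst ` slit_tangent_bundle A)"
      and XY: "X \<in> tangent_space (slit_tangent_bundle A) u" "Y \<in> tangent_space (slit_tangent_bundle A) u"
    then obtain c where c: "c \<in> A" "u \<in> fst (slit_chart A c)" using cover by blast
    show "J_Q A g u (a *\<^sub>R X + b *\<^sub>R Y) = a *\<^sub>R J_Q A g u X + b *\<^sub>R J_Q A g u Y"
      by (rule J_Q_linear[OF M g c XY])
  next
    fix c' w
    assume "c' \<in> slit_tangent_bundle A"
    then obtain c where c: "c \<in> A" "c' = slit_chart A c"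
      unfolding slit_tangent_bundle_def by blast
    show "smooth_on (snd c' ` fst c')
       (\<lambda>x. J_Q A g (chart_inv c' x) (tangent_of (slit_tangent_bundle A) c' (chart_inv c' x) w) c')"
      unfolding c(2) by (rule smooth_on_J_Q[OF M g c(1)])
  qed
  have sq: "J_Q A g u (J_Q A g u X) = - X"
    if u: "u \<in> \<Union>(fst ` slit_tangent_bundle A)" and X: "X \<in> tangent_space (slit_tangent_bundle A) u" for u X
  proof -
    obtain c where c: "c \<in> A" "u \<in> fst (slit_chart A c)" using cover[OF u] by blast
    show ?thesis by (rule J_Q_squared[OF M g c X])
  qed
  have comp: "h_Q A g u (J_Q A g u X) (J_Q A g u Y) = h_Q A g u X Y"
    if u: "u \<in> \<Union>(fst ` slit_tangent_bundle A)"
      and XY: "X \<in> tangent_space (slit_tangent_bundle A) u" "Y \<in> tangent_space (slit_tangent_bundle A) u"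
    for u X Y
  proof -
    obtain c where c: "c \<in> A" "u \<in> fst (slit_chart A c)" using cover[OF u] by blast
    show ?thesis by (rule h_Q_J_Q[OF M g c XY])
  qed
  show "almost_hermitian (slit_tangent_bundle A) (h_Q A g) (J_Q A g)"
    unfolding almost_hermitian_def by (intro conjI ballI metric endo sq comp)
qed (rule fundamental_form_eq[OF assms])

end
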